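(* Let $V$ be the $\mathcal O_q$-module, with all associated notation, described in the context, and put $$M=\frac{aK-a^{-1}B}{a-a^{-1}},\qquad M^\downarrow=\frac{aK^\downarrow-a^{-1}B^\downarrow}{a-a^{-1}}.$$ Consider the directed graph with six vertices $[0],[d],[0^*],[d^*],[0^-],[d^-]$ (the flags defined in the context) and the following ten arcs, each labelled by an invertible element of $\mathrm{End}(V)$: $[0^*]\to[0]$ labelled $B$; $[0^*]\to[d]$ labelled $K$; $[d^*]\to[0]$ labelled $B^\downarrow$; $[d^*]\to[d]$ labelled $K^\downarrow$; $[0]\to[0^-]$ labelled $a^{-1}A-a^{-2}B$; $[d]\to[0^-]$ labelled $aA-a^2K$; $[0]\to[d^-]$ labelled $a^{-1}A-a^{-2}B^\downarrow$; $[d]\to[d^-]$ labelled $aA-a^2K^\downarrow$; $[0^-]\to[0^*]$ labelled $M^{-1}$; $[d^-]\to[d^*]$ labelled $(M^\downarrow)^{-1}$. Then for each oriented 3-cycle in this graph, the labels of its three consecutive arcs (in the cyclic order of the cycle) form an equitable triple on $V$. Explicitly, the oriented 3-cycles give the equitable triples $(aA-a^2K,\,M^{-1},\,K)$, $(a^{-1}A-a^{-2}B,\,M^{-1},\,B)$, $(aA-a^2K^\downarrow,\,(M^\downarrow)^{-1},\,K^\downarrow)$, $(a^{-1}A-a^{-2}B^\downarrow,\,(M^\downarrow)^{-1},\,B^\downarrow)$.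
   Context: Setting. $\mathbb F$ is a field and $q\in\mathbb F$ is nonzero and not a root of unity. Algebras are associative, unital, over $\mathbb F$. Write $[X,Y]=XY-YX$, $[X,Y]_q=qXY-q^{-1}YX$, $[X,Y]_{q^{-1}}=q^{-1}XY-qYX$. The $q$-Onsager algebra $\mathcal O_q$ is defined by generators $A,A^*$ and relations $[A,[A,[A,A^*]_q]_{q^{-1}}]=(q^2-q^{-2})^2[A^*,A]$ and $[A^*,[A^*,[A^*,A]_q]_{q^{-1}}]=(q^2-q^{-2})^2[A,A^*]$. $V$ is an irreducible $\mathcal O_q$-module of finite dimension at least $2$ on which each of $A,A^*$ is diagonalizable; elements of $\mathcal O_q$ are identified with their actions on $V$. Eigenspaces. The eigenvalues of $A$ on $V$ can be ordered as mutually distinct $\theta_0,\dots,\theta_d$ ($d\ge 1$) such that $\theta_i=aq^{d-2i}+a^{-1}q^{2i-d}$ ($0\le i\le d$) for some nonzero $a\in\mathbb F$; fix such an ordering and $a$. $V_i$ is the $\theta_i$-eigenspace of $A$ and $E_i\in\mathrm{End}(V)$ is the projection onto $V_i$ along $\bigoplus_{j\ne i}V_j$; one has $A^*V_i\subseteq V_{i-1}+V_i+V_{i+1}$ ($V_{-1}=V_{d+1}=0$). $A^*$ also has exactly $d+1$ eigenspaces on $V$, and they can be ordered $V^*_0,\dots,V^*_d$ so that $AV^*_i\subseteq V^*_{i-1}+V^*_i+V^*_{i+1}$ ($V^*_{-1}=V^*_{d+1}=0$); fix such an ordering and let $\theta_i^*$ be the eigenvalue of $A^*$ on $V^*_i$.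 One has $a^2\ne 1$. Lusztig automorphism. $L$ is the automorphism of $\mathcal O_q$ with $L(A)=A$, $L(A^* )=A^*+\frac{[A,[A,A^*]_q]}{(q-q^{-1})(q^2-q^{-2})}$; its inverse satisfies $L^{-1}(A)=A$, $L^{-1}(A^* )=A^*+\frac{[A,[A,A^*]_{q^{-1}}]}{(q-q^{-1})(q^2-q^{-2})}$. The map $H$. Let $t_{ij}=1+\frac{\theta_i-\theta_j}{q-q^{-1}}\cdot\frac{q\theta_i-q^{-1}\theta_j}{q^2-q^{-2}}$, $t_i=t_{01}t_{12}\cdots t_{i-1,i}$ ($t_0=1$), and $H=\sum_{i=0}^d t_iE_i\in\mathrm{End}(V)$; each $t_i\neq0$, so $H$ is invertible. Put $V^-_i=HV^*_i$ ($0\le i\le d$); $V^-_i$ is the eigenspace of $L^{-1}(A^* )$ on $V$ with eigenvalue $\theta^*_i$. Maps. A decomposition of $V$ is a sequence $\{W_i\}_{i=0}^d$ of nonzero subspaces with direct sum $V$; its corresponding map is the element of $\mathrm{End}(V)$ acting on $W_i$ as $q^{d-2i}$ times the identity ($0\le i\le d$). $K,B,K^\downarrow,B^\downarrow$ are the maps corresponding to the decompositions $\{W_i\}_{i=0}^d$ (each known to be a decomposition) given respectively by: $K$: $W_i=(V^*_0+\cdots+V^*_i)\cap(V_i+\cdots+V_d)$; $B$: $W_i=(V^*_0+\cdots+V^*_i)\cap(V_0+\cdots+V_{d-i})$; $K^\downarrow$: $W_i=(V^*_{d-i}+\cdots+V^*_d)\cap(V_i+\cdots+V_d)$; $B^\downarrow$: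 $W_i=(V^*_{d-i}+\cdots+V^*_d)\cap(V_0+\cdots+V_{d-i})$. The maps $M$, $M^\downarrow$ of the claim are known to be invertible. Flags (used only as vertex names of the graph). For $0\le i\le d$ put $[0]_i=V_0+\cdots+V_i$, $[d]_i=V_{d-i}+\cdots+V_d$, $[0^*]_i=V^*_0+\cdots+V^*_i$, $[d^*]_i=V^*_{d-i}+\cdots+V^*_d$, $[0^-]_i=V^-_0+\cdots+V^-_i$, $[d^-]_i=V^-_{d-i}+\cdots+V^-_d$. Each arc $F\to G$ of the graph records that its label $T$ is diagonalizable with eigenvalues $\{q^{d-2i}\}_{i=0}^d$ and, with $T_i$ its $q^{d-2i}$-eigenspace, $T_0+\cdots+T_i=F_i$ and $T_{d-i}+\cdots+T_d=G_i$ ($0\le i\le d$). Equitable triple. An equitable triple on $V$ is a 3-tuple $X,Y,Z$ of invertible elements of $\mathrm{End}(V)$ such that $\frac{qXY-q^{-1}YX}{q-q^{-1}}=I$, $\frac{qYZ-q^{-1}ZY}{q-q^{-1}}=I$, $\frac{qZX-q^{-1}XZ}{q-q^{-1}}=I$ (this condition is invariant under cyclic rotation of $X,Y,Z$). *)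

theory Defs
  imports Complex_Main "HOL-Library.Poly_Mapping" "HOL-Algebra.QuotRing"
begin

section \<open>The q-Onsager algebra by generators and relations\<close>

datatype gen = GenA | GenAstar

datatype word = Word (letters: "gen list")

instantiation word :: monoid_add
begin
definition "0 = Word []"
definition "u + v = Word (letters u @ letters v)"
instance by standard (simp_all add: zero_word_def plus_word_def)
end

text \<open>Words in the generators form the free monoid, written additively so that
  the following type with its convolution product is the free associative unital
  algebra over \<open>'f\<close> on the two generators.\<close>

type_synonym 'f free_alg = "(word, 'f) poly_mapping"

definition fscalar :: "'f::field \<Rightarrow> 'f free_alg" where
  "fscalar c = Poly_Mapping.single 0 c"

definition fgen :: "gen \<Rightarrow> ('f::field) free_alg" where
  "fgen g = Poly_Mapping.single (Word [g]) 1"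

definition comm :: "('f::field) free_alg \<Rightarrow> 'f free_alg \<Rightarrow> 'f free_alg" where
  "comm X Y = X * Y - Y * X"

text \<open>\<open>[X,Y]\<^sub>q\<close>; the bracket with subscript \<open>1/q\<close> is \<open>qcomm (inverse q)\<close>.\<close>
definition qcomm :: "'f::field \<Rightarrow> 'f free_alg \<Rightarrow> 'f free_alg \<Rightarrow> 'f free_alg" where
  "qcomm q X Y = fscalar q * (X * Y) - fscalar (inverse q) * (Y * X)"

definition onsager_relator :: "'f::field \<Rightarrow> 'f free_alg \<Rightarrow> 'f free_alg \<Rightarrow> 'f free_alg" where
  "onsager_relator q X Y =
     comm X (qcomm (inverse q) X (qcomm q X Y))
       - fscalar ((q ^ 2 - inverse q ^ 2) ^ 2) * comm Y X"

definition free_ring :: "('f::field) free_alg ring" where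
  "free_ring = \<lparr>carrier = UNIV, mult = (*), one = 1, zero = 0, add = (+)\<rparr>"

definition onsager_ideal :: "'f::field \<Rightarrow> 'f free_alg set" where
  "onsager_ideal q = genideal free_ring
     {onsager_relator q (fgen GenA) (fgen GenAstar), onsager_relator q (fgen GenAstar) (fgen GenA)}"

definition q_onsager :: "'f::field \<Rightarrow> 'f free_alg set ring" where
  "q_onsager q = free_ring Quot onsager_ideal q"

definition oq_class :: "'f::field \<Rightarrow> 'f free_alg \<Rightarrow> 'f free_alg set" where
  "oq_class q x = onsager_ideal q +>\<^bsub>free_ring\<^esub> x"


section \<open>Modules\<close>

text \<open>Throughout, the vector space \<open>V\<close> is a whole type \<open>'v\<close> with scalar multiplication \<open>scale\<close>.\<close>

definition endo_ring :: "('f::field \<Rightarrow> 'v::ab_group_add \<Rightarrow> 'v) \<Rightarrow> ('v \<Rightarrow> 'v) ring" where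
  "endo_ring scale = \<lparr>carrier = {T. Vector_Spaces.linear scale scale T},
     mult = (\<circ>), one = id, zero = (\<lambda>v. 0), add = (\<lambda>S T v. S v + T v)\<rparr>"

definition onsager_module ::
  "('f::field \<Rightarrow> 'v::ab_group_add \<Rightarrow> 'v) \<Rightarrow> 'f \<Rightarrow> ('f free_alg set \<Rightarrow> 'v \<Rightarrow> 'v) \<Rightarrow> bool" where
  "onsager_module scale q \<rho> \<longleftrightarrow>
     vector_space scale \<and> \<rho> \<in> ring_hom (q_onsager q) (endo_ring scale) \<and>
     (\<forall>c. \<rho> (oq_class q (fscalar c)) = scale c)"

definition irreducible_onsager_module ::
  "('f::field \<Rightarrow> 'v::ab_group_add \<Rightarrow> 'v) \<Rightarrow> 'f \<Rightarrow> ('f free_alg set \<Rightarrow> 'v \<Rightarrow> 'v) \<Rightarrow> bool" where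
  "irreducible_onsager_module scale q \<rho> \<longleftrightarrow>
     onsager_module scale q \<rho> \<and> (UNIV :: 'v set) \<noteq> {0} \<and>
     (\<forall>W. module.subspace scale W \<and> (\<forall>x\<in>carrier (q_onsager q). \<forall>w\<in>W. \<rho> x w \<in> W)
        \<longrightarrow> W = {0} \<or> W = UNIV)"


section \<open>Eigenspaces, decompositions and flags\<close>

definition eigspace :: "('f::field \<Rightarrow> 'v::ab_group_add \<Rightarrow> 'v) \<Rightarrow> ('v \<Rightarrow> 'v) \<Rightarrow> 'f \<Rightarrow> 'v set" where
  "eigspace scale T c = {v. T v = scale c v}"

definition eigvals :: "('f::field \<Rightarrow> 'v::ab_group_add \<Rightarrow> 'v) \<Rightarrow> ('v \<Rightarrow> 'v) \<Rightarrow> 'f set" where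
  "eigvals scale T = {c. \<exists>v. v \<noteq> 0 \<and> T v = scale c v}"

definition diagonalizable :: "('f::field \<Rightarrow> 'v::ab_group_add \<Rightarrow> 'v) \<Rightarrow> ('v \<Rightarrow> 'v) \<Rightarrow> bool" where
  "diagonalizable scale T \<longleftrightarrow>
     (\<exists>S. \<not> module.dependent scale S \<and> module.span scale S = UNIV \<and>
          (\<forall>v\<in>S. \<exists>c. T v = scale c v))"

text \<open>The sum of the subspaces \<open>W j\<close>, \<open>j \<in> J\<close>, for finite \<open>J\<close>.\<close>
definition subspace_sum :: "(nat \<Rightarrow> 'v::ab_group_add set) \<Rightarrow> nat set \<Rightarrow> 'v set" where
  "subspace_sum W J = {\<Sum>j\<in>J. w j | w. \<forall>j\<in>J. w j \<in> W j}"

definition theta :: "'f::field \<Rightarrow> 'f \<Rightarrow> nat \<Rightarrow> nat \<Rightarrow> 'f" where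
  "theta q a d i = a * q powi (int d - 2 * int i) + inverse a * q powi (2 * int i - int d)"

text \<open>The element of \<open>End(V)\<close> corresponding to the decomposition \<open>W 0, \<dots>, W d\<close>; the description
  is uniquely satisfied whenever \<open>V\<close> is the direct sum of these subspaces.\<close>
definition map_of_decomp ::
  "('f::field \<Rightarrow> 'v::ab_group_add \<Rightarrow> 'v) \<Rightarrow> 'f \<Rightarrow> nat \<Rightarrow> (nat \<Rightarrow> 'v set) \<Rightarrow> 'v \<Rightarrow> 'v" where
  "map_of_decomp scale q d W =
     (THE T. Vector_Spaces.linear scale scale T \<and>
        (\<forall>i\<le>d. \<forall>w\<in>W i. T w = scale (q powi (int d - 2 * int i)) w))"

text \<open>The projection onto \<open>W i\<close> along the sum of the other \<open>W j\<close>, \<open>j \<le> d\<close>.\<close>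
definition projection ::
  "('f::field \<Rightarrow> 'v::ab_group_add \<Rightarrow> 'v) \<Rightarrow> nat \<Rightarrow> (nat \<Rightarrow> 'v set) \<Rightarrow> nat \<Rightarrow> 'v \<Rightarrow> 'v" where
  "projection scale d W i =
     (THE E. Vector_Spaces.linear scale scale E \<and> (\<forall>w\<in>W i. E w = w) \<and>
        (\<forall>j\<le>d. j \<noteq> i \<longrightarrow> (\<forall>w\<in>W j. E w = 0)))"

definition t2 :: "'f::field \<Rightarrow> 'f \<Rightarrow> nat \<Rightarrow> nat \<Rightarrow> nat \<Rightarrow> 'f" where
  "t2 q a d i j = 1 + (theta q a d i - theta q a d j) / (q - inverse q)
       * ((q * theta q a d i - inverse q * theta q a d j) / (q ^ 2 - inverse q ^ 2))"

definition t1 :: "'f::field \<Rightarrow> 'f \<Rightarrow> nat \<Rightarrow> nat \<Rightarrow> 'f" where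
  "t1 q a d i = (\<Prod>k<i. t2 q a d k (Suc k))"

text \<open>\<open>V 0, \<dots>, V d\<close> are the eigenspaces of \<open>A\<close> for \<open>theta q a d 0, \<dots>, theta q a d d\<close>.\<close>
definition H_map ::
  "('f::field \<Rightarrow> 'v::ab_group_add \<Rightarrow> 'v) \<Rightarrow> 'f \<Rightarrow> 'f \<Rightarrow> nat \<Rightarrow> (nat \<Rightarrow> 'v set) \<Rightarrow> 'v \<Rightarrow> 'v" where
  "H_map scale q a d V v = (\<Sum>i\<le>d. scale (t1 q a d i) (projection scale d V i v))"


section \<open>The graph\<close>

datatype vname = V0 | Vd | V0star | Vdstar | V0minus | Vdminus

definition flag ::
  "('f::field \<Rightarrow> 'v::ab_group_add \<Rightarrow> 'v) \<Rightarrow> 'f \<Rightarrow> 'f \<Rightarrow> nat \<Rightarrow> (nat \<Rightarrow> 'v set) \<Rightarrow> (nat \<Rightarrow> 'v set)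
     \<Rightarrow> vname \<Rightarrow> nat \<Rightarrow> 'v set" where
  "flag scale q a d V Vs n i =
     (case n of
        V0 \<Rightarrow> subspace_sum V {0..i}
      | Vd \<Rightarrow> subspace_sum V {d - i..d}
      | V0star \<Rightarrow> subspace_sum Vs {0..i}
      | Vdstar \<Rightarrow> subspace_sum Vs {d - i..d}
      | V0minus \<Rightarrow> subspace_sum (\<lambda>j. H_map scale q a d V ` Vs j) {0..i}
      | Vdminus \<Rightarrow> subspace_sum (\<lambda>j. H_map scale q a d V ` Vs j) {d - i..d})"

text \<open>A vertex is a flag tagged with its name: the six vertices are distinct by name, whether or
  not two of the flags happen to coincide as sequences of subspaces.\<close>
type_synonym 'v vertex = "vname \<times> (nat \<Rightarrow> 'v set)"

text \<open>A labelled directed graph is its set of arcs (source, label, target).  The argument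
  \<open>F\<close> gives the flag of each name.\<close>
definition flag_graph ::
  "('f::field \<Rightarrow> 'v::ab_group_add \<Rightarrow> 'v) \<Rightarrow> 'f \<Rightarrow> (vname \<Rightarrow> nat \<Rightarrow> 'v set) \<Rightarrow> ('v \<Rightarrow> 'v) \<Rightarrow>
   ('v \<Rightarrow> 'v) \<Rightarrow> ('v \<Rightarrow> 'v) \<Rightarrow> ('v \<Rightarrow> 'v) \<Rightarrow> ('v \<Rightarrow> 'v) \<Rightarrow> ('v \<Rightarrow> 'v) \<Rightarrow> ('v \<Rightarrow> 'v) \<Rightarrow>
   ('v vertex \<times> ('v \<Rightarrow> 'v) \<times> 'v vertex) set" where
  "flag_graph scale a F A K B Kd Bd M Md =
     (\<lambda>(m, T, n). ((m, F m), T, (n, F n))) `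
     {(V0star, B, V0), (V0star, K, Vd), (Vdstar, Bd, V0), (Vdstar, Kd, Vd),
      (V0, (\<lambda>v. scale (inverse a) (A v) - scale (inverse a ^ 2) (B v)), V0minus),
      (Vd, (\<lambda>v. scale a (A v) - scale (a ^ 2) (K v)), V0minus),
      (V0, (\<lambda>v. scale (inverse a) (A v) - scale (inverse a ^ 2) (Bd v)), Vdminus),
      (Vd, (\<lambda>v. scale a (A v) - scale (a ^ 2) (Kd v)), Vdminus),
      (V0minus, inv_into UNIV M, V0star), (Vdminus, inv_into UNIV Md, Vdstar)}"

text \<open>Label triples of the oriented 3-cycles.  Both lists of labels and cycles are taken with a
  starting arc, so each 3-cycle contributes its three cyclic rotations.\<close>
definition three_cycle_labels :: "('n \<times> 'l \<times> 'n) set \<Rightarrow> ('l \<times> 'l \<times> 'l) set" where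
  "three_cycle_labels G =
     {(X, Y, Z). \<exists>u v w. distinct [u, v, w] \<and> (u, X, v) \<in> G \<and> (v, Y, w) \<in> G \<and> (w, Z, u) \<in> G}"

definition rotations :: "'l \<times> 'l \<times> 'l \<Rightarrow> ('l \<times> 'l \<times> 'l) set" where
  "rotations t = (case t of (X, Y, Z) \<Rightarrow> {(X, Y, Z), (Y, Z, X), (Z, X, Y)})"

definition equitable_triple ::
  "('f::field \<Rightarrow> 'v::ab_group_add \<Rightarrow> 'v) \<Rightarrow> 'f \<Rightarrow> ('v \<Rightarrow> 'v) \<times> ('v \<Rightarrow> 'v) \<times> ('v \<Rightarrow> 'v) \<Rightarrow> bool" where
  "equitable_triple scale q t = (case t of (X, Y, Z) \<Rightarrow>
     (\<forall>T\<in>{X, Y, Z}. Vector_Spaces.linear scale scale T \<and> bij T) \<and>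
     (\<forall>(S, T)\<in>{(X, Y), (Y, Z), (Z, X)}. \<forall>v.
        scale (inverse (q - inverse q)) (scale q (S (T v)) - scale (inverse q) (T (S v))) = v))"

end

theory Submission
  imports Defs
begin

text \<open>
  Write \<open>F n\<close> for the sum of the first \<open>n\<close> eigenspaces of \<open>A\<^sup>*\<close>, in the given order, and put
  \<open>c = q - q\<^sup>-\<^sup>1\<close>.  The maps \<open>K\<close> and \<open>B\<close> both act as \<open>q\<^sup>d\<^sup>-\<^sup>2\<^sup>i\<close> on \<open>F (i + 1) / F i\<close>, so the combination
  \<open>M\<close> does as well, and it is invertible.  The proof replaces \<open>K\<close> and \<open>B\<close> by \<open>M\<close> and
  \<open>N = (K - B) / (a\<^sup>-\<^sup>1 - a)\<close>, which lowers the flag \<open>F\<close>; thus \<open>K = M + a\<^sup>-\<^sup>1 N\<close> and \<open>B = M + a N\<close>.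
  The operator \<open>A\<close> maps a summand of the split decomposition defining \<open>K\<close> into itself and the
  next one, which gives \<open>q K A - q\<^sup>-\<^sup>1 A K = c (a K\<^sup>2 + a\<^sup>-\<^sup>1)\<close>; for \<open>B\<close> the same holds with \<open>a\<close>
  inverted.  Given these two relations, the equitable relations are all consequences of the
  single identity \<open>q N M = q\<^sup>-\<^sup>1 M N\<close>.

  To prove it, let \<open>Q = q N M - q\<^sup>-\<^sup>1 M N\<close>.  This map lowers \<open>F\<close>, and the relations with \<open>A\<close> imply
  \<open>q\<^sup>2 Q A - q\<^sup>-\<^sup>2 A Q = c ((a + a\<^sup>-\<^sup>1) (q Q M + q\<^sup>-\<^sup>1 M Q) + (q + q\<^sup>-\<^sup>1) (N Q + Q N))\<close>
  (lemma \<open>commutator_defect_relation\<close>).  Since \<open>A\<close> raises \<open>F\<close> by one step while \<open>M\<close> and \<open>N\<close>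
  preserve it, the leading part of \<open>Q\<close> on the graded space of \<open>F\<close> commutes with the raising part
  of \<open>A\<close> up to a scalar.  The raising part satisfies a hard Lefschetz property: its power of
  exponent \<open>d - 2 i\<close> is an isomorphism from the graded piece at \<open>i\<close> to the one at \<open>d - i\<close>
  (lemmas \<open>lefschetz_injective\<close> and \<open>lefschetz_surjective\<close>).  A lowering map that commutes with it
  up to a scalar vanishes: as in an \<open>sl\<^sub>2\<close>-module, everything is obtained by raising lowest weight
  vectors, and a lowest weight vector killed by a power of the raising map would be sent to a
  piece on which that power is injective.  Hence the leading part of \<open>Q\<close> is zero in every degree, and \<open>Q = 0\<close>
  (lemma \<open>lowering_map_vanishes\<close>).

  Both the split decompositions and the Lefschetz property come from irreducibility through
  the fact that \<open>F n\<close> meets \<open>V\<^sub>n + \<dots> + V\<^sub>d\<close> trivially (lemma \<open>F_G_disjoint\<close>), used also for the reversed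
  ordering of the \<open>V\<^sub>i\<close>.  Reversing that ordering inverts \<open>a\<close> and exchanges \<open>K\<close> with \<open>B\<close>; reversing
  the ordering of the \<open>V\<^sup>*\<^sub>i\<close> turns \<open>K, B, M\<close> into their counterparts with an arrow.
\<close>

section \<open>Direct sums and eigenspace decompositions\<close>

locale linear_algebra = vector_space scale
  for scale :: "'f::field \<Rightarrow> 'v::ab_group_add \<Rightarrow> 'v"
begin

abbreviation endo :: "('v \<Rightarrow> 'v) \<Rightarrow> bool" where
  "endo T \<equiv> Vector_Spaces.linear scale scale T"

lemma endoI:
  assumes "\<And>x y. T (x + y) = T x + T y" "\<And>c x. T (scale c x) = scale c (T x)"
  shows "endo T"
  using assms by unfold_locales auto

lemma endo_simps:
  assumes "endo T"
  shows "T (x + y) = T x + T y" "T (x - y) = T x - T y" "T 0 = 0" "T (- x) = - T x"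
    "T (scale c x) = scale c (T x)" "T (sum f I) = (\<Sum>i\<in>I. T (f i))"
proof -
  interpret T: Vector_Spaces.linear scale scale T by fact
  show "T (x + y) = T x + T y" "T (x - y) = T x - T y" "T 0 = 0" "T (- x) = - T x"
    "T (scale c x) = scale c (T x)" "T (sum f I) = (\<Sum>i\<in>I. T (f i))"
    by (simp_all add: T.add T.diff T.zero T.neg T.scale T.sum)
qed

lemma subspace_eigspace: "endo T \<Longrightarrow> subspace (eigspace scale T c)"
  by (auto simp: subspace_def eigspace_def endo_simps[of T] scale_right_distrib scale_left_commute)

lemma subspace_subspace_sum:
  assumes "\<And>j. j \<in> J \<Longrightarrow> subspace (W j)"
  shows "subspace (subspace_sum W J)"
  unfolding subspace_def
proof (intro conjI ballI allI)
  show "0 \<in> subspace_sum W J"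
    unfolding subspace_sum_def using assms
    by (auto intro!: exI[of _ "\<lambda>_. 0"] simp: subspace_0)
next
  fix x y assume "x \<in> subspace_sum W J" "y \<in> subspace_sum W J"
  then obtain u w where "x = (\<Sum>j\<in>J. u j)" "\<forall>j\<in>J. u j \<in> W j" "y = (\<Sum>j\<in>J. w j)" "\<forall>j\<in>J. w j \<in> W j"
    unfolding subspace_sum_def by blast
  then show "x + y \<in> subspace_sum W J"
    unfolding subspace_sum_def using assms
    by (auto intro!: exI[of _ "\<lambda>j. u j + w j"] simp: sum.distrib subspace_add)
next
  fix c x assume "x \<in> subspace_sum W J"
  then obtain u where "x = (\<Sum>j\<in>J. u j)" "\<forall>j\<in>J. u j \<in> W j"
    unfolding subspace_sum_def by blast
  then show "scale c x \<in> subspace_sum W J"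
    unfolding subspace_sum_def using assms
    by (auto intro!: exI[of _ "\<lambda>j. scale c (u j)"] simp: scale_sum_right subspace_scale)
qed

lemma subspace_sum_upper:
  assumes "finite J" "j \<in> J" "\<And>i. i \<in> J \<Longrightarrow> subspace (W i)"
  shows "W j \<subseteq> subspace_sum W J"
proof
  fix x assume "x \<in> W j"
  then show "x \<in> subspace_sum W J"
    unfolding subspace_sum_def using assms
    by (auto intro!: exI[of _ "\<lambda>i. if i = j then x else 0"] simp: sum.delta subspace_0)
qed

lemma eigenvectors_independent:
  assumes T: "endo T" and "finite J" "inj_on th J"
    and "\<And>j. j \<in> J \<Longrightarrow> w j \<in> eigspace scale T (th j)" "(\<Sum>j\<in>J. w j) = 0" "j \<in> J"
  shows "w j = 0"
  using assms(2-6)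
proof (induction J arbitrary: w j rule: finite_induct)
  case empty
  then show ?case by simp
next
  case (insert h J)
  have eig: "T (w i) = scale (th i) (w i)" if "i \<in> insert h J" for i
    using insert.prems(2)[OF that] by (simp add: eigspace_def)
  have "(\<Sum>i\<in>J. scale (th i - th h) (w i)) = (\<Sum>i\<in>insert h J. scale (th i - th h) (w i))"
    using insert.hyps by simp
  also have "\<dots> = T (\<Sum>i\<in>insert h J. w i) - scale (th h) (\<Sum>i\<in>insert h J. w i)"
    using eig by (simp add: endo_simps[OF T] scale_sum_right sum_subtractf scale_left_diff_distrib
        del: sum.insert)
  also have "\<dots> = 0"
    using insert.prems(3) by (simp add: endo_simps[OF T] del: sum.insert)
  finally have s0: "(\<Sum>i\<in>J. scale (th i - th h) (w i)) = 0" .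
  have "scale (th i - th h) (w i) = 0" if "i \<in> J" for i
  proof (rule insert.IH[OF _ _ s0 that])
    show "inj_on th J" using insert.prems(1) by (simp add: inj_on_insert)
    show "scale (th i - th h) (w i) \<in> eigspace scale T (th i)" if "i \<in> J" for i
      using insert.prems(2)[of i] that subspace_eigspace[OF T] by (simp add: subspace_scale)
  qed
  then have J0: "w i = 0" if "i \<in> J" for i
    using that insert.prems(1) insert.hyps by (auto simp: inj_on_def)
  then have "w h = 0"
    using insert.prems(3) insert.hyps by simp
  then show ?case using J0 insert.prems(4) by auto
qed

lemma diagonalizable_sum_eigspaces:
  assumes T: "endo T" and diag: "diagonalizable scale T" and ev: "eigvals scale T = th ` {0..d}"
  shows "subspace_sum (\<lambda>i. eigspace scale T (th i)) {..d} = UNIV"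
proof -
  let ?W = "subspace_sum (\<lambda>i. eigspace scale T (th i)) {..d}"
  from diag obtain S where S: "independent S" "span S = UNIV" "\<forall>v\<in>S. \<exists>c. T v = scale c v"
    unfolding diagonalizable_def by (elim exE conjE)
  have "v \<in> ?W" if vS: "v \<in> S" for v
  proof -
    have "v \<noteq> 0" using S(1) vS dependent_zero[of S] by metis
    moreover obtain c where c: "T v = scale c v" using bspec[OF S(3) vS] by (rule exE)
    ultimately have "c \<in> eigvals scale T" by (simp add: eigvals_def) metis
    then obtain i where "i \<le> d" "c = th i" using ev by auto
    have "(\<lambda>i. eigspace scale T (th i)) i \<subseteq> ?W"
      by (rule subspace_sum_upper[where W = "\<lambda>i. eigspace scale T (th i)"])
        (use \<open>i \<le> d\<close> in \<open>simp_all add: subspace_eigspace[OF T]\<close>)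
    moreover have "v \<in> eigspace scale T (th i)"
      using c \<open>c = th i\<close> by (simp add: eigspace_def)
    ultimately show ?thesis by blast
  qed
  then have "S \<subseteq> ?W" by (rule subsetI)
  then have "span S \<subseteq> ?W"
    by (intro span_minimal subspace_subspace_sum subspace_eigspace[OF T])
  then show ?thesis using S(2) by auto
qed

end

locale direct_decomposition = linear_algebra scale
  for scale :: "'f::field \<Rightarrow> 'v::ab_group_add \<Rightarrow> 'v" +
  fixes W :: "nat \<Rightarrow> 'v set" and d :: nat
  assumes subspace_summand: "i \<le> d \<Longrightarrow> subspace (W i)"
    and sum_summands: "subspace_sum W {..d} = UNIV"
    and summands_independent:
      "(\<And>j. j \<le> d \<Longrightarrow> w j \<in> W j) \<Longrightarrow> (\<Sum>j\<le>d. w j) = 0 \<Longrightarrow> i \<le> d \<Longrightarrow> w i = 0"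
begin

definition component :: "'v \<Rightarrow> nat \<Rightarrow> 'v" where
  "component v = (SOME w. (\<forall>j\<le>d. w j \<in> W j) \<and> v = (\<Sum>j\<le>d. w j))"

lemma component_spec: "(\<forall>j\<le>d. component v j \<in> W j) \<and> v = (\<Sum>j\<le>d. component v j)"
proof -
  let ?P = "\<lambda>w. (\<forall>j\<le>d. w j \<in> W j) \<and> v = (\<Sum>j\<le>d. w j)"
  have "v \<in> subspace_sum W {..d}" by (simp add: sum_summands)
  then have "\<exists>w. ?P w" unfolding subspace_sum_def by auto
  then show ?thesis unfolding component_def by (rule someI_ex[of ?P])
qed

lemma component_in: "j \<le> d \<Longrightarrow> component v j \<in> W j"
  using component_spec by blast

lemma sum_component: "(\<Sum>j\<le>d. component v j) = v"
  by (rule component_spec[THEN conjunct2, symmetric])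

lemma component_unique:
  assumes "\<And>j. j \<le> d \<Longrightarrow> w j \<in> W j" "(\<Sum>j\<le>d. w j) = v" "j \<le> d"
  shows "component v j = w j"
proof -
  have "component v j - w j = 0"
  proof (rule summands_independent[OF _ _ assms(3)])
    show "component v j - w j \<in> W j" if "j \<le> d" for j
      using that assms(1) component_in subspace_summand by (simp add: subspace_diff)
    show "(\<Sum>j\<le>d. component v j - w j) = 0"
      using assms(2) by (simp add: sum_subtractf sum_component)
  qed
  then show ?thesis by simp
qed

lemma component_add: "j \<le> d \<Longrightarrow> component (u + v) j = component u j + component v j"
  by (rule component_unique[where w = "\<lambda>j. component u j + component v j"])
    (auto simp: sum.distrib sum_component subspace_summand component_in subspace_add)

lemma component_scale: "j \<le> d \<Longrightarrow> component (scale c v) j = scale c (component v j)"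
  by (rule component_unique[where w = "\<lambda>j. scale c (component v j)"])
    (auto simp: scale_sum_right[symmetric] sum_component subspace_summand component_in subspace_scale)

lemma component_diff: "j \<le> d \<Longrightarrow> component (u - v) j = component u j - component v j"
  by (rule component_unique[where w = "\<lambda>j. component u j - component v j"])
    (auto simp: sum_subtractf sum_component subspace_summand component_in subspace_diff)

lemma component_summand:
  assumes "w \<in> W i" "i \<le> d" "j \<le> d"
  shows "component w j = (if j = i then w else 0)"
  by (rule component_unique[where w = "\<lambda>j. if j = i then w else 0", OF _ _ assms(3)])
    (use assms in \<open>auto simp: sum.delta subspace_summand subspace_0\<close>)

text \<open>A sum of some of the summands is cut out by the vanishing of the other components.  All
  inclusions between such sums are obtained by comparing components.\<close>

lemma mem_subspace_sum_iff:
  assumes "J \<subseteq> {..d}"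
  shows "v \<in> subspace_sum W J \<longleftrightarrow> (\<forall>j\<le>d. j \<notin> J \<longrightarrow> component v j = 0)"
proof
  assume "v \<in> subspace_sum W J"
  then obtain w where w: "\<forall>j\<in>J. w j \<in> W j" "v = (\<Sum>j\<in>J. w j)"
    unfolding subspace_sum_def by auto
  have "component v j = (if j \<in> J then w j else 0)" if "j \<le> d" for j
  proof (rule component_unique[where w = "\<lambda>j. if j \<in> J then w j else 0", OF _ _ that])
    show "(if j \<in> J then w j else 0) \<in> W j" if "j \<le> d" for j
      using that w subspace_summand by (auto simp: subspace_0)
    show "(\<Sum>j\<le>d. if j \<in> J then w j else 0) = v"
      unfolding w(2) by (rule sum.mono_neutral_cong_right) (use assms in auto)
  qed
  then show "\<forall>j\<le>d. j \<notin> J \<longrightarrow> component v j = 0" by simp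
next
  assume R: "\<forall>j\<le>d. j \<notin> J \<longrightarrow> component v j = 0"
  have "v = (\<Sum>j\<le>d. component v j)" by (simp add: sum_component)
  also have "\<dots> = (\<Sum>j\<in>J. component v j)"
    by (rule sum.mono_neutral_right) (use assms R in auto)
  finally show "v \<in> subspace_sum W J"
    unfolding subspace_sum_def using assms component_in by (intro CollectI exI) auto
qed

lemma map_of_decomp_properties:
  assumes "T = map_of_decomp scale q d W"
  shows "endo T" and "\<And>i w. i \<le> d \<Longrightarrow> w \<in> W i \<Longrightarrow> T w = scale (q powi (int d - 2 * int i)) w"
proof -
  let ?k = "\<lambda>i. q powi (int d - 2 * int i)"
  let ?Q = "\<lambda>T. endo T \<and> (\<forall>i\<le>d. \<forall>w\<in>W i. T w = scale (?k i) w)"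
  define T' where "T' v = (\<Sum>j\<le>d. scale (?k j) (component v j))" for v
  have "?Q T'"
  proof (intro conjI allI impI ballI endoI)
    show "T' (x + y) = T' x + T' y" for x y
      unfolding T'_def by (simp add: component_add scale_right_distrib sum.distrib)
    show "T' (scale c x) = scale c (T' x)" for c x
      unfolding T'_def by (simp add: component_scale scale_sum_right mult.commute)
    fix i w assume "i \<le> d" "w \<in> W i"
    then have "T' w = (\<Sum>j\<le>d. if j = i then scale (?k i) w else 0)"
      unfolding T'_def by (intro sum.cong) (auto simp: component_summand)
    then show "T' w = scale (?k i) w" using \<open>i \<le> d\<close> by simp
  qed
  moreover have "S = T'" if "?Q S" for S
  proof
    fix v
    have "S v = S (\<Sum>j\<le>d. component v j)" by (simp add: sum_component)
    also have "\<dots> = T' v"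
      unfolding T'_def using that component_in by (simp add: endo_simps[of S])
    finally show "S v = T' v" .
  qed
  ultimately have "?Q (THE T. ?Q T)" by (rule theI[where P = ?Q])
  then have "?Q T" unfolding assms map_of_decomp_def .
  then show "endo T" and "\<And>i w. i \<le> d \<Longrightarrow> w \<in> W i \<Longrightarrow> T w = scale (?k i) w"
    by blast+
qed

end

locale eigen_decomposition = linear_algebra scale
  for scale :: "'f::field \<Rightarrow> 'v::ab_group_add \<Rightarrow> 'v" +
  fixes T :: "'v \<Rightarrow> 'v" and th :: "nat \<Rightarrow> 'f" and d :: nat
  assumes endo: "endo T"
    and eigenvalues_distinct: "inj_on th {..d}"
    and sum_eigspaces: "subspace_sum (\<lambda>i. eigspace scale T (th i)) {..d} = UNIV"
begin

abbreviation E :: "nat \<Rightarrow> 'v set" where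
  "E i \<equiv> eigspace scale T (th i)"

sublocale direct_decomposition scale E d
proof
  show "subspace (E i)" for i by (rule subspace_eigspace[OF endo])
  show "subspace_sum E {..d} = UNIV" by (rule sum_eigspaces)
  show "w i = 0" if "\<And>j. j \<le> d \<Longrightarrow> w j \<in> E j" "(\<Sum>j\<le>d. w j) = 0" "i \<le> d" for w i
    using eigenvectors_independent[OF endo _ eigenvalues_distinct, of w i] that by auto
qed

text \<open>The index counts the eigenspaces that are present or absent, respectively.  The zero
  subspace belongs to both flags, as \<open>lower 0\<close> and \<open>upper (d + 1)\<close>, which gives the inductions along
  the flags a trivial starting point.\<close>

definition lower :: "nat \<Rightarrow> 'v set" where
  "lower n = subspace_sum E {j. j < n \<and> j \<le> d}"

definition upper :: "nat \<Rightarrow> 'v set" where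
  "upper n = subspace_sum E {n..d}"

lemma lower_iff: "v \<in> lower n \<longleftrightarrow> (\<forall>j\<le>d. n \<le> j \<longrightarrow> component v j = 0)"
  unfolding lower_def by (subst mem_subspace_sum_iff) (auto simp: not_less)

lemma upper_iff: "v \<in> upper n \<longleftrightarrow> (\<forall>j\<le>d. j < n \<longrightarrow> component v j = 0)"
  unfolding upper_def by (subst mem_subspace_sum_iff) (auto simp: not_le)

lemma subspace_lower: "subspace (lower n)" and subspace_upper: "subspace (upper n)"
  unfolding lower_def upper_def by (intro subspace_subspace_sum subspace_eigspace endo)+

lemma zero_of_components: "(\<And>j. j \<le> d \<Longrightarrow> component v j = 0) \<Longrightarrow> v = 0"
  using sum_component[of v] by simp

lemma component_0: "j \<le> d \<Longrightarrow> component 0 j = 0"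
  using component_diff[of j 0 0] by simp

lemma lower_0: "lower 0 = {0}"
proof (intro Set.set_eqI iffI)
  fix v assume "v \<in> lower 0"
  then have "\<forall>j\<le>d. component v j = 0" by (simp add: lower_iff)
  then have "v = 0" using zero_of_components by blast
  then show "v \<in> {0}" by simp
qed (simp add: lower_iff component_0)

lemma upper_top: "upper (Suc d) = {0}"
proof (intro Set.set_eqI iffI)
  fix v assume "v \<in> upper (Suc d)"
  then have "\<forall>j\<le>d. component v j = 0" by (simp add: upper_iff)
  then have "v = 0" using zero_of_components by blast
  then show "v \<in> {0}" by simp
qed (simp add: upper_iff component_0)

lemma lower_top: "d < n \<Longrightarrow> lower n = UNIV" and upper_0: "upper 0 = UNIV"
  by (auto simp: lower_iff upper_iff)

lemma lower_mono: "m \<le> n \<Longrightarrow> lower m \<subseteq> lower n" and upper_mono: "m \<le> n \<Longrightarrow> upper n \<subseteq> upper m"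
  by (auto simp: lower_iff upper_iff)

lemma component_shift:
  "j \<le> d \<Longrightarrow> component (T v - scale c v) j = scale (th j - c) (component v j)"
proof -
  assume j: "j \<le> d"
  have "component (T v) j = scale (th j) (component v j)"
  proof (rule component_unique[where w = "\<lambda>j. scale (th j) (component v j)", OF _ _ j])
    show "scale (th j) (component v j) \<in> E j" if "j \<le> d" for j
      using component_in[OF that] subspace_summand[OF that] by (simp add: subspace_scale)
    have "T v = T (\<Sum>j\<le>d. component v j)" by (simp add: sum_component)
    also have "\<dots> = (\<Sum>j\<le>d. scale (th j) (component v j))"
      using component_in by (simp add: endo_simps[OF endo] eigspace_def)
    finally show "(\<Sum>j\<le>d. scale (th j) (component v j)) = T v" by simp
  qed
  then show ?thesis by (simp add: component_diff component_scale j scale_left_diff_distrib)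
qed

lemma lower_shift: "v \<in> lower (Suc n) \<Longrightarrow> T v - scale (th n) v \<in> lower n"
  unfolding lower_iff
proof (intro allI impI)
  fix j assume "\<forall>j\<le>d. Suc n \<le> j \<longrightarrow> component v j = 0" "j \<le> d" "n \<le> j"
  then show "component (T v - scale (th n) v) j = 0"
    by (cases "j = n") (auto simp: component_shift)
qed

lemma upper_shift: "v \<in> upper n \<Longrightarrow> T v - scale (th n) v \<in> upper (Suc n)"
  unfolding upper_iff by (auto simp: component_shift less_Suc_eq)

lemma tridiagonal_lower_upper:
  assumes X: "endo X"
    and tri: "\<And>i. i \<le> d \<Longrightarrow> X ` E i \<subseteq> subspace_sum E {j. j \<le> d \<and> i \<le> j + 1 \<and> j \<le> i + 1}"
  shows "v \<in> lower n \<Longrightarrow> X v \<in> lower (Suc n)" and "v \<in> upper (Suc n) \<Longrightarrow> X v \<in> upper n"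
proof -
  have comp: "component (X (component v i)) j = 0" if "i \<le> d" "j \<le> d" "Suc i < j \<or> Suc j < i" for i j
  proof -
    have "X (component v i) \<in> subspace_sum E {j. j \<le> d \<and> i \<le> j + 1 \<and> j \<le> i + 1}"
      using tri[OF that(1)] component_in[OF that(1)] by blast
    then show ?thesis
      by (subst (asm) mem_subspace_sum_iff) (use that in auto)
  qed
  have Xv: "X v = (\<Sum>i\<le>d. X (component v i))"
    using endo_simps(6)[OF X, of "component v" "{..d}"] by (simp add: sum_component)
  {
    assume v: "v \<in> lower n"
    have "X (component v i) \<in> lower (Suc n)" if "i \<le> d" for i
    proof (cases "n \<le> i")
      case True
      then show ?thesis using v that by (simp add: lower_iff endo_simps[OF X] component_0)
    next
      case False
      then show ?thesis unfolding lower_iff using comp that by auto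
    qed
    then show "X v \<in> lower (Suc n)"
      unfolding Xv by (intro subspace_sum[OF subspace_lower]) auto
  }
  {
    assume v: "v \<in> upper (Suc n)"
    have "X (component v i) \<in> upper n" if "i \<le> d" for i
    proof (cases "i \<le> n")
      case True
      then show ?thesis using v that by (simp add: upper_iff endo_simps[OF X] component_0)
    next
      case False
      then show ?thesis unfolding upper_iff using comp that by auto
    qed
    then show "X v \<in> upper n"
      unfolding Xv by (intro subspace_sum[OF subspace_upper]) auto
  }
qed

end

section \<open>Split decompositions of a tridiagonal system\<close>

lemma (in linear_algebra) invariant_span:
  assumes "endo X" "\<And>x. x \<in> S \<Longrightarrow> X x \<in> span S" "w \<in> span S"
  shows "X w \<in> span S"
proof -
  have "subspace {v. X v \<in> span S}"
    unfolding subspace_def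
    by (auto simp: endo_simps[OF assms(1)] span_zero intro: span_add span_scale)
  then have "span S \<subseteq> {v. X v \<in> span S}"
    by (rule span_minimal[rotated]) (use assms(2) in auto)
  then show ?thesis using assms(3) by auto
qed

locale tridiagonal_system = linear_algebra scale
  + A: eigen_decomposition scale A th d + As: eigen_decomposition scale As ths d
  for scale :: "'f::field \<Rightarrow> 'v::ab_group_add \<Rightarrow> 'v" and A As th ths d +
  assumes A_tridiagonal:
      "i \<le> d \<Longrightarrow> A ` As.E i \<subseteq> subspace_sum As.E {j. j \<le> d \<and> i \<le> j + 1 \<and> j \<le> i + 1}"
    and As_tridiagonal:
      "i \<le> d \<Longrightarrow> As ` A.E i \<subseteq> subspace_sum A.E {j. j \<le> d \<and> i \<le> j + 1 \<and> j \<le> i + 1}"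
    and irreducible:
      "subspace W \<Longrightarrow> (\<And>w. w \<in> W \<Longrightarrow> A w \<in> W) \<Longrightarrow> (\<And>w. w \<in> W \<Longrightarrow> As w \<in> W)
        \<Longrightarrow> W = {0} \<or> W = UNIV"
    and A_eigspace_nonzero: "i \<le> d \<Longrightarrow> A.E i \<noteq> {0}"
    and As_eigspace_nonzero: "i \<le> d \<Longrightarrow> As.E i \<noteq> {0}"
begin

text \<open>\<open>F\<close> grows with the index and \<open>G\<close> shrinks; their indices count the eigenspaces of \<open>A\<^sup>*\<close> that are
  present and those of \<open>A\<close> that are absent.\<close>

abbreviation F :: "nat \<Rightarrow> 'v set" where "F \<equiv> As.lower"
abbreviation G :: "nat \<Rightarrow> 'v set" where "G \<equiv> A.upper"

lemmas A_F = As.tridiagonal_lower_upper(1)[OF A.endo A_tridiagonal]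
lemmas As_G = A.tridiagonal_lower_upper(2)[OF As.endo As_tridiagonal]

lemma shifts:
  assumes "v \<in> F m" "v \<in> G n"
  shows "A v - scale (th n) v \<in> F (Suc m) \<inter> G (Suc n)"
    and "As v - scale (ths (m - 1)) v \<in> F (m - 1) \<inter> G (n - 1)"
proof -
  have "v \<in> F (Suc m)" using assms As.lower_mono[of m "Suc m"] by auto
  then show "A v - scale (th n) v \<in> F (Suc m) \<inter> G (Suc n)"
    using assms A.upper_shift[of v n] A_F[of v m] As.subspace_lower
    by (auto intro: subspace_diff subspace_scale)
  have v': "v \<in> G (n - 1)" using assms(2) A.upper_mono[of "n - 1" n] by auto
  have "As v \<in> G (n - 1)" using As_G[of v "n - 1"] assms(2) by (cases n) (auto simp: A.upper_0)
  then have "As v - scale (ths (m - 1)) v \<in> G (n - 1)"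
    using v' A.subspace_upper by (auto intro: subspace_diff subspace_scale)
  moreover have "As v - scale (ths (m - 1)) v \<in> F (m - 1)"
  proof (cases m)
    case 0
    then have "v = 0" using assms(1) by (simp add: As.lower_0)
    then show ?thesis by (simp add: endo_simps[OF As.endo] subspace_0[OF As.subspace_lower])
  next
    case (Suc k)
    then show ?thesis using assms(1) As.lower_shift[of v k] by simp
  qed
  ultimately show "As v - scale (ths (m - 1)) v \<in> F (m - 1) \<inter> G (n - 1)" by blast
qed

text \<open>The sum of the intersections \<open>F (n + s) \<inter> G n\<close> is invariant under both operators: on
  \<open>F m \<inter> G n\<close> the map \<open>A - \<theta>\<^sub>n\<close> raises and \<open>A\<^sup>* - \<theta>\<^sup>*\<^sub>m\<^sub>-\<^sub>1\<close> lowers both indices by one.  Irreducibility leaves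
  two possibilities for it.\<close>

lemma diagonal_sum_trivial:
  "span (\<Union>n. F (n + s) \<inter> G n) = {0} \<or> span (\<Union>n. F (n + s) \<inter> G n) = UNIV"
proof (rule irreducible)
  let ?S = "\<Union>n. F (n + s) \<inter> G n"
  show "subspace (span ?S)" by (rule subspace_span)
  show "A w \<in> span ?S" if "w \<in> span ?S" for w
  proof (rule invariant_span[OF A.endo _ that])
    fix v assume v: "v \<in> ?S"
    then obtain n where "v \<in> F (n + s)" "v \<in> G n" by blast
    from shifts(1)[OF this] have "A v - scale (th n) v \<in> ?S" by (intro UN_I[of "Suc n"]) auto
    then have "(A v - scale (th n) v) + scale (th n) v \<in> span ?S"
      using v by (intro span_add span_scale span_base)
    then show "A v \<in> span ?S" by simp
  qed
  show "As w \<in> span ?S" if "w \<in> span ?S" for w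
  proof (rule invariant_span[OF As.endo _ that])
    fix v assume v: "v \<in> ?S"
    then obtain n where n: "v \<in> F (n + s)" "v \<in> G n" by blast
    let ?c = "ths (n + s - 1)"
    have "As v - scale ?c v \<in> ?S"
    proof (cases n)
      case 0
      \<comment> \<open>Here only the index of \<open>F\<close> can drop; the flag \<open>G\<close> starts with the whole space.\<close>
      have "As v - scale ?c v \<in> F (0 + s)"
        using shifts(2)[OF n] As.lower_mono[of "n + s - 1" s] 0 by auto
      then show ?thesis by (intro UN_I[of 0]) (auto simp: A.upper_0)
    next
      case (Suc k)
      then show ?thesis using shifts(2)[OF n] by (intro UN_I[of k]) auto
    qed
    then have "(As v - scale ?c v) + scale ?c v \<in> span ?S"
      using v by (intro span_add span_scale span_base)
    then show "As v \<in> span ?S" by simp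
  qed
qed

text \<open>For \<open>s = 0\<close> the invariant sum lies in \<open>G 1\<close>, which misses the first eigenspace of \<open>A\<close>; for
  \<open>s = 1\<close> it contains the first eigenspace of \<open>A\<^sup>*\<close>.\<close>

lemma F_G_disjoint: "F n \<inter> G n = {0}"
proof -
  let ?S = "\<Union>n. F (n + 0) \<inter> G n"
  have "F n \<inter> G n \<subseteq> G 1" for n
    using A.upper_mono[of 1 n] subspace_0[OF A.subspace_upper] by (cases n) (auto simp: As.lower_0)
  then have "span ?S \<subseteq> G 1"
    by (intro span_minimal A.subspace_upper) auto
  moreover have "G 1 \<noteq> UNIV"
  proof
    assume top: "G 1 = UNIV"
    obtain v where v: "v \<in> A.E 0" "v \<noteq> 0"
      using A_eigspace_nonzero[of 0] subspace_0[OF A.subspace_summand[of 0]] by blast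
    then have "A.component v 0 = 0" using top by (auto simp: A.upper_iff set_eq_iff)
    then show False using v A.component_summand[of v 0 0] by simp
  qed
  ultimately have "span ?S = {0}" using diagonal_sum_trivial[of 0] by auto
  moreover have "F n \<inter> G n \<subseteq> span ?S" by (rule subset_trans[OF _ span_superset]) auto
  ultimately show ?thesis
    using subspace_0[OF A.subspace_upper] subspace_0[OF As.subspace_lower] by blast
qed

lemma span_split: "span (\<Union>n. F (Suc n) \<inter> G n) = UNIV"
proof -
  obtain v where v: "v \<in> As.E 0" "v \<noteq> 0"
    using As_eigspace_nonzero[of 0] subspace_0[OF As.subspace_summand[of 0]] by blast
  have "v \<in> F (0 + 1) \<inter> G 0"
    using v(1) by (auto simp: A.upper_0 As.lower_iff As.component_summand)
  then have "v \<in> span (\<Union>n. F (n + 1) \<inter> G n)" by (intro span_base UN_I[of 0]) auto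
  then show ?thesis using diagonal_sum_trivial[of 1] v(2) by auto
qed

lemma F_G_sum:
  obtains f g where "f \<in> F n" "g \<in> G n" "v = f + g"
proof -
  let ?P = "{v. \<exists>f\<in>F n. \<exists>g\<in>G n. v = f + g}"
  have P: "?P = {f + g | f g. f \<in> F n \<and> g \<in> G n}" by (auto simp: Bex_def)
  have "subspace ?P"
    unfolding P by (rule subspace_sums[OF As.subspace_lower A.subspace_upper])
  moreover have "(\<Union>n. F (Suc n) \<inter> G n) \<subseteq> ?P"
  proof (rule UN_least, rule subsetI)
    fix m u assume u: "u \<in> F (Suc m) \<inter> G m"
    show "u \<in> ?P"
    proof (cases "m < n")
      case True
      then have "u \<in> F n" using u As.lower_mono[of "Suc m" n] by auto
      then show ?thesis using subspace_0[OF A.subspace_upper[of n]]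
        by (intro CollectI bexI[of _ u] bexI[of _ 0]) simp_all
    next
      case False
      then have "u \<in> G n" using u A.upper_mono[of n m] by auto
      then show ?thesis using subspace_0[OF As.subspace_lower[of n]]
        by (intro CollectI bexI[of _ 0] bexI[of _ u]) simp_all
    qed
  qed
  ultimately have "span (\<Union>n. F (Suc n) \<inter> G n) \<subseteq> ?P" by (intro span_minimal)
  then have "v \<in> ?P" unfolding span_split by (rule subsetD) simp
  then show thesis by (elim CollectE bexE) (rule that)
qed

lemma split_complement:
  assumes "v \<in> F (Suc n)"
  obtains f u where "f \<in> F n" "u \<in> F (Suc n) \<inter> G n" "v = f + u"
proof -
  obtain f g where fg: "f \<in> F n" "g \<in> G n" "v = f + g" by (rule F_G_sum)
  then have "g = v - f" by simp
  moreover have "f \<in> F (Suc n)" using fg As.lower_mono[of n "Suc n"] by auto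
  ultimately have "g \<in> F (Suc n)" using assms subspace_diff[OF As.subspace_lower] by blast
  then show thesis using that fg by blast
qed

sublocale split: direct_decomposition scale "\<lambda>i. F (Suc i) \<inter> G i" d
proof
  let ?U = "\<lambda>i. F (Suc i) \<inter> G i"
  show sub: "subspace (?U i)" for i
    by (intro subspace_inter As.subspace_lower A.subspace_upper)
  have "(\<Union>n. ?U n) \<subseteq> subspace_sum ?U {..d}"
  proof (rule UN_least)
    fix n show "?U n \<subseteq> subspace_sum ?U {..d}"
    proof (cases "n \<le> d")
      case True
      then show ?thesis
        using subspace_sum_upper[of "{..d}" n ?U] sub by auto
    next
      case False
      then have "?U n \<subseteq> {0}" using A.upper_mono[of "Suc d" n] A.upper_top by auto
      moreover have "subspace (subspace_sum ?U {..d})" by (intro subspace_subspace_sum sub)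
      ultimately show ?thesis using subspace_0 by blast
    qed
  qed
  then show "subspace_sum ?U {..d} = UNIV"
    using span_split span_minimal[of "\<Union>n. ?U n" "subspace_sum ?U {..d}"]
      subspace_subspace_sum[of "{..d}" ?U] sub by blast
  show "w i = 0" if w: "\<And>j. j \<le> d \<Longrightarrow> w j \<in> ?U j" "(\<Sum>j\<le>d. w j) = 0" "i \<le> d" for w i
  proof -
    \<comment> \<open>The top nonzero term would lie in \<open>F n \<inter> G n\<close>.\<close>
    have "\<forall>j\<le>d. n \<le> j \<longrightarrow> w j = 0" if "n \<le> Suc d" for n
      using that
    proof (induction n rule: inc_induct)
      case base
      then show ?case by simp
    next
      case (step n)
      have n: "n \<le> d" using step.hyps by simp
      have "(\<Sum>j\<le>d. w j) = (\<Sum>j\<in>{..<n} \<union> {n}. w j)"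
        by (rule sum.mono_neutral_right) (use n step.IH in auto)
      then have "w n = - (\<Sum>j<n. w j)"
        using w(2) by (simp add: eq_neg_iff_add_eq_0)
      moreover have "w j \<in> F n" if "j < n" for j
        using w(1)[of j] that n As.lower_mono[of "Suc j" n] by auto
      then have "- (\<Sum>j<n. w j) \<in> F n"
        by (intro subspace_neg subspace_sum As.subspace_lower) auto
      ultimately have "w n \<in> F n \<inter> G n" using w(1)[OF n] by auto
      then have "w n = 0" using F_G_disjoint by auto
      then show ?case using step.IH by (auto simp: le_less_Suc_eq Suc_le_eq order_le_less)
    qed
    from this[of 0] show ?thesis using w(3) by simp
  qed
qed

end

subsection \<open>Reversing the orderings\<close>

text \<open>The conditions on a tridiagonal system are symmetric under reversal of either ordering.  Each
  of the four split decompositions is therefore the standard one of a suitably reversed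
  system.\<close>

lemma subspace_sum_rev:
  assumes "J \<subseteq> {..d}"
  shows "subspace_sum (\<lambda>j. W (d - j)) J = subspace_sum W ((\<lambda>j. d - j) ` J)"
proof -
  have inj: "inj_on (\<lambda>j. d - j) J"
    using assms by (intro inj_onI) (metis atMost_iff diff_diff_cancel subsetD)
  show ?thesis
  proof (intro Set.set_eqI iffI)
    fix v assume "v \<in> subspace_sum (\<lambda>j. W (d - j)) J"
    then obtain w where w: "\<forall>j\<in>J. w j \<in> W (d - j)" "v = sum w J"
      unfolding subspace_sum_def by blast
    have "v = (\<Sum>j\<in>(\<lambda>j. d - j) ` J. w (d - j))"
      unfolding w(2) by (subst sum.reindex[OF inj]) (use assms in \<open>auto intro!: sum.cong\<close>)
    moreover have "\<forall>j\<in>(\<lambda>j. d - j) ` J. w (d - j) \<in> W j" using w(1) assms by auto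
    ultimately show "v \<in> subspace_sum W ((\<lambda>j. d - j) ` J)"
      unfolding subspace_sum_def by (intro CollectI exI[of _ "\<lambda>j. w (d - j)"] conjI)
  next
    fix v assume "v \<in> subspace_sum W ((\<lambda>j. d - j) ` J)"
    then obtain w where w: "\<forall>j\<in>(\<lambda>j. d - j) ` J. w j \<in> W j" "v = sum w ((\<lambda>j. d - j) ` J)"
      unfolding subspace_sum_def by blast
    have "v = (\<Sum>j\<in>J. w (d - j))" unfolding w(2) by (subst sum.reindex[OF inj]) simp
    then show "v \<in> subspace_sum (\<lambda>j. W (d - j)) J"
      unfolding subspace_sum_def using w(1)
      by (intro CollectI exI[of _ "\<lambda>j. w (d - j)"] conjI) auto
  qed
qed

lemma (in eigen_decomposition) reversed: "eigen_decomposition scale T (\<lambda>i. th (d - i)) d"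
proof (intro eigen_decomposition.intro eigen_decomposition_axioms.intro linear_algebra_axioms)
  show "Vector_Spaces.linear scale scale T" by (rule endo)
  show "inj_on (\<lambda>i. th (d - i)) {..d}"
  proof (rule inj_onI)
    fix i j assume ij: "i \<in> {..d}" "j \<in> {..d}" "th (d - i) = th (d - j)"
    then have "d - i = d - j" by (intro inj_onD[OF eigenvalues_distinct ij(3)]) auto
    then show "i = j" using ij by auto
  qed
  have "(\<lambda>j. d - j) ` {..d} = {..d}"
  proof (intro Set.set_eqI iffI)
    fix j assume "j \<in> {..d}"
    then have "j = d - (d - j)" "d - j \<in> {..d}" by auto
    then show "j \<in> (\<lambda>j. d - j) ` {..d}" by blast
  qed auto
  then show "subspace_sum (\<lambda>i. eigspace scale T (th (d - i))) {..d} = UNIV"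
    using subspace_sum_rev[of "{..d}" d E] sum_eigspaces by simp
qed

lemma (in eigen_decomposition) tridiagonal_reversed:
  assumes "\<And>i. i \<le> d \<Longrightarrow> X ` E i \<subseteq> subspace_sum E {j. j \<le> d \<and> i \<le> j + 1 \<and> j \<le> i + 1}" "i \<le> d"
  shows "X ` E (d - i) \<subseteq> subspace_sum (\<lambda>j. E (d - j)) {j. j \<le> d \<and> i \<le> j + 1 \<and> j \<le> i + 1}"
proof -
  have "(\<lambda>j. d - j) ` {j. j \<le> d \<and> i \<le> j + 1 \<and> j \<le> i + 1}
      = {j. j \<le> d \<and> d - i \<le> j + 1 \<and> j \<le> d - i + 1}" (is "?f ` ?J = ?K")
  proof (intro Set.set_eqI iffI)
    fix j assume "j \<in> ?K"
    then have "j = d - (d - j)" "d - j \<in> ?J" using assms(2) by auto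
    then show "j \<in> ?f ` ?J" by blast
  qed (use assms(2) in auto)
  then show ?thesis
    using assms(1)[of "d - i"] by (subst subspace_sum_rev) auto
qed

lemma (in tridiagonal_system) reversed_A:
  "tridiagonal_system scale A As (\<lambda>i. th (d - i)) ths d"
proof -
  interpret R: eigen_decomposition scale A "\<lambda>i. th (d - i)" d by (rule A.reversed)
  show ?thesis
    by unfold_locales
      (use A_tridiagonal A.tridiagonal_reversed[OF As_tridiagonal] irreducible
        A_eigspace_nonzero As_eigspace_nonzero in auto)
qed

lemma (in tridiagonal_system) reversed_As:
  "tridiagonal_system scale A As th (\<lambda>i. ths (d - i)) d"
proof -
  interpret R: eigen_decomposition scale As "\<lambda>i. ths (d - i)" d by (rule As.reversed)
  show ?thesis
    by unfold_locales
      (use As.tridiagonal_reversed[OF A_tridiagonal] As_tridiagonal irreducible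
        A_eigspace_nonzero As_eigspace_nonzero in auto)
qed

section \<open>A hard Lefschetz property of the raising operator\<close>

context eigen_decomposition
begin

text \<open>The product of the factors \<open>T - \<theta>\<^sub>k\<close> for \<open>i \<le> k < i + m\<close>, a monic polynomial in \<open>T\<close>.\<close>

primrec shift_chain :: "nat \<Rightarrow> nat \<Rightarrow> 'v \<Rightarrow> 'v" where
  "shift_chain i 0 v = v"
| "shift_chain i (Suc m) v = T (shift_chain i m v) - scale (th (i + m)) (shift_chain i m v)"

lemma shift_chain_add: "shift_chain i m (u + v) = shift_chain i m u + shift_chain i m v"
  by (induction m) (simp_all add: endo_simps[OF endo] scale_right_distrib)

lemma component_shift_chain:
  "j \<le> d \<Longrightarrow> component (shift_chain i m v) j = scale (\<Prod>k<m. th j - th (i + k)) (component v j)"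
  by (induction m) (simp_all add: component_shift mult.commute)

lemma shift_chain_lower:
  assumes "v \<in> lower (i + m)"
  shows "shift_chain i m v \<in> lower i"
  unfolding lower_iff
proof (intro allI impI)
  fix j assume j: "j \<le> d" "i \<le> j"
  show "component (shift_chain i m v) j = 0"
  proof (cases "i + m \<le> j")
    case True
    then show ?thesis using assms j by (simp add: component_shift_chain lower_iff)
  next
    case False
    then have "j - i \<in> {..<m}" "th j - th (i + (j - i)) = 0" using j by auto
    then have "(\<Prod>k<m. th j - th (i + k)) = 0" by (intro prod_zero) blast+
    then show ?thesis using j by (simp add: component_shift_chain)
  qed
qed

lemma shift_chain_factor_nonzero:
  assumes "i + m \<le> j" "j \<le> d"
  shows "(\<Prod>k<m. th j - th (i + k)) \<noteq> 0"
proof -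
  have "th j \<noteq> th (i + k)" if "k < m" for k
    using inj_onD[OF eigenvalues_distinct, of j "i + k"] that assms by auto
  then show ?thesis by auto
qed

lemma shift_chain_kernel:
  assumes "shift_chain i m v = 0"
  shows "v \<in> lower (i + m)"
  unfolding lower_iff
proof (intro allI impI)
  fix j assume j: "j \<le> d" "i + m \<le> j"
  then show "component v j = 0"
    using component_shift_chain[of j i m v] shift_chain_factor_nonzero[of i m j] assms
    by (simp add: component_0)
qed

lemma shift_chain_upper_surj:
  assumes "v \<in> upper (i + m)"
  obtains u where "shift_chain i m u = v"
proof
  let ?w = "\<lambda>j. scale (inverse (\<Prod>k<m. th j - th (i + k))) (component v j)"
  have w: "component (\<Sum>j\<le>d. ?w j) j = ?w j" if "j \<le> d" for j
    by (rule component_unique[where w = ?w, OF _ refl that])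
      (use component_in subspace_summand in \<open>auto simp: subspace_scale\<close>)
  have "shift_chain i m (\<Sum>j\<le>d. ?w j) - v = 0"
  proof (rule zero_of_components)
    fix j assume j: "j \<le> d"
    show "component (shift_chain i m (\<Sum>j\<le>d. ?w j) - v) j = 0"
    proof (cases "i + m \<le> j")
      case True
      then show ?thesis
        using shift_chain_factor_nonzero[of i m j] j
        by (simp add: component_diff component_shift_chain w del: prod_zero_iff)
    next
      case False
      then show ?thesis
        using assms j by (simp add: component_diff component_shift_chain w upper_iff)
    qed
  qed
  then show "shift_chain i m (\<Sum>j\<le>d. ?w j) = v" by simp
qed

lemma upper_reversed:
  assumes "n \<le> Suc d"
  shows "eigen_decomposition.upper scale T (\<lambda>i. th (d - i)) d n = lower (Suc d - n)"
proof -
  interpret R: eigen_decomposition scale T "\<lambda>i. th (d - i)" d by (rule reversed)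
  have "(\<lambda>j. d - j) ` {n..d} = {j. j < Suc d - n \<and> j \<le> d}"
  proof (intro Set.set_eqI iffI)
    fix j assume "j \<in> {j. j < Suc d - n \<and> j \<le> d}"
    then have "j = d - (d - j)" "d - j \<in> {n..d}" by auto
    then show "j \<in> (\<lambda>j. d - j) ` {n..d}" by blast
  qed auto
  then show ?thesis
    using subspace_sum_rev[of "{n..d}" d E] by (simp add: R.upper_def lower_def)
qed

end

context tridiagonal_system
begin

abbreviation D :: "nat \<Rightarrow> 'v set" where "D \<equiv> A.lower"

lemma F_D_disjoint: "n \<le> Suc d \<Longrightarrow> F n \<inter> D (Suc d - n) = {0}"
  using tridiagonal_system.F_G_disjoint[OF reversed_A, of n] by (simp add: A.upper_reversed)

lemma F_D_sum:
  assumes "n \<le> Suc d"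
  obtains f g where "f \<in> F n" "g \<in> D (Suc d - n)" "v = f + g"
  using tridiagonal_system.F_G_sum[OF reversed_A, of n v] assms by (auto simp: A.upper_reversed)

lemma F_add: "u \<in> F n \<Longrightarrow> v \<in> F n \<Longrightarrow> u + v \<in> F n"
  and F_diff: "u \<in> F n \<Longrightarrow> v \<in> F n \<Longrightarrow> u - v \<in> F n"
  and F_scale: "v \<in> F n \<Longrightarrow> scale c v \<in> F n"
  by (simp_all add: subspace_add subspace_diff subspace_scale As.subspace_lower)

lemma F_mono: "v \<in> F m \<Longrightarrow> m \<le> n \<Longrightarrow> v \<in> F n"
  using As.lower_mono by blast

lemma zero_in_F: "0 \<in> F n"
  by (rule subspace_0[OF As.subspace_lower])

lemma A_power_F: "v \<in> F n \<Longrightarrow> (A ^^ m) v \<in> F (n + m)"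
  by (induction m) (simp_all add: A_F)

lemma A_power_F_diff: "v \<in> F (n - j) \<Longrightarrow> (A ^^ m) v \<in> F (n + m - j)"
proof (cases "j \<le> n")
  case True
  then show "v \<in> F (n - j) \<Longrightarrow> (A ^^ m) v \<in> F (n + m - j)"
    using A_power_F[of v "n - j" m] by simp
next
  case False
  moreover have "(A ^^ m) 0 = 0" by (induction m) (simp_all add: endo_simps[OF A.endo])
  ultimately show "v \<in> F (n - j) \<Longrightarrow> (A ^^ m) v \<in> F (n + m - j)"
    by (simp add: As.lower_0 zero_in_F)
qed

lemma endo_A_power: "endo (A ^^ m)"
  by (induction m) (auto intro!: endoI simp: endo_simps[OF A.endo] endo_simps[of "A ^^ _"])

lemma shift_chain_F: "v \<in> F n \<Longrightarrow> A.shift_chain i m v \<in> F (n + m)"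
  by (induction m) (auto intro!: F_diff F_scale A_F elim: F_mono)

lemma shift_chain_power: "v \<in> F (Suc i) \<Longrightarrow> A.shift_chain i m v - (A ^^ m) v \<in> F (i + m)"
proof (induction m)
  case 0
  then show ?case by (simp add: zero_in_F)
next
  case (Suc m)
  have "A (A.shift_chain i m v - (A ^^ m) v) \<in> F (Suc (i + m))"
    using Suc by (intro A_F)
  moreover have "scale (th (i + m)) (A.shift_chain i m v) \<in> F (Suc (i + m))"
    using shift_chain_F[OF Suc.prems, of i m] by (simp add: F_scale)
  ultimately have "A (A.shift_chain i m v - (A ^^ m) v) - scale (th (i + m)) (A.shift_chain i m v)
      \<in> F (Suc (i + m))" by (rule F_diff)
  then show ?case by (simp add: endo_simps[OF A.endo] algebra_simps)
qed

lemma shift_chain_split: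
  "u \<in> F (Suc i) \<inter> G i \<Longrightarrow> A.shift_chain i m u \<in> F (Suc (i + m)) \<inter> G (i + m)"
  by (induction m) (use shifts(1) in auto)

text \<open>On the graded pieces \<open>F (i + 1) / F i\<close> the operator \<open>A\<close> has degree one.  Modulo lower terms, a
  power of \<open>A\<close> may be replaced by a product of factors \<open>A - \<theta>\<^sub>k\<close>, and the product over
  \<open>i \<le> k < d - i\<close> maps the complement \<open>F (i + 1) \<inter> G i\<close> of \<open>F i\<close> to the complement \<open>F (d - i + 1) \<inter> G (d - i)\<close>
  of \<open>F (d - i)\<close>.  Its kernel lies in \<open>D (d - i)\<close>, which meets \<open>F (i + 1)\<close> trivially.\<close>

lemma lefschetz_injective:
  assumes "2 * i \<le> d" "v \<in> F (Suc i)" "(A ^^ (d - 2 * i)) v \<in> F (d - i)"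
  shows "v \<in> F i"
proof -
  let ?m = "d - 2 * i"
  have im: "i + ?m = d - i" using assms(1) by simp
  obtain f u where fu: "f \<in> F i" "u \<in> F (Suc i) \<inter> G i" "v = f + u"
    by (rule split_complement[OF assms(2)])
  have "(A ^^ ?m) v - (A ^^ ?m) f \<in> F (d - i)"
    using assms(3) A_power_F[OF fu(1), of ?m] unfolding im by (rule F_diff)
  then have "(A ^^ ?m) u \<in> F (d - i)" by (simp add: fu(3) endo_simps[OF endo_A_power])
  then have "(A.shift_chain i ?m u - (A ^^ ?m) u) + (A ^^ ?m) u \<in> F (d - i)"
    using shift_chain_power[of u i ?m] fu(2) by (intro F_add) (auto simp: im)
  then have "A.shift_chain i ?m u \<in> F (d - i) \<inter> G (d - i)"
    using shift_chain_split[OF fu(2), of ?m] by (simp add: im)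
  then have "A.shift_chain i ?m u = 0" using F_G_disjoint by blast
  then have "u \<in> F (Suc i) \<inter> D (Suc d - Suc i)"
    using A.shift_chain_kernel[of i ?m u] fu(2) by (simp add: im)
  then have "u = 0" using F_D_disjoint[of "Suc i"] assms(1) by auto
  then show ?thesis using fu by simp
qed

text \<open>The product of factors \<open>A - \<theta>\<^sub>k\<close> is invertible on \<open>G (d - i)\<close>, so an element of the upper
  complement has a preimage in \<open>V\<close>.  Writing this preimage as a sum along \<open>V = F (i + 1) + D (d - i)\<close>
  leaves an unwanted second part, whose image lies in \<open>F (d - i + 1) \<inter> D i = 0\<close>.\<close>

lemma lefschetz_surjective:
  assumes "2 * i \<le> d" "y \<in> F (Suc (d - i))"
  obtains x where "x \<in> F (Suc i)" "y - (A ^^ (d - 2 * i)) x \<in> F (d - i)"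
proof -
  let ?m = "d - 2 * i" and ?t = "A.shift_chain i (d - 2 * i)"
  have im: "i + ?m = d - i" using assms(1) by simp
  obtain f y0 where y: "f \<in> F (d - i)" "y0 \<in> F (Suc (d - i)) \<inter> G (d - i)" "y = f + y0"
    by (rule split_complement[OF assms(2)])
  then obtain y' where y': "?t y' = y0"
    using A.shift_chain_upper_surj[of y0 i ?m] by (auto simp: im)
  obtain f1 g where g: "f1 \<in> F (Suc i)" "g \<in> D (Suc d - Suc i)" "y' = f1 + g"
    by (rule F_D_sum[of "Suc i"]) (use assms(1) in auto)
  obtain f2 u where u: "f2 \<in> F i" "u \<in> F (Suc i) \<inter> G i" "f1 = f2 + u"
    by (rule split_complement[OF g(1)])
  have sum: "y0 = ?t f2 + ?t u + ?t g"
    by (simp add: y'[symmetric] g(3) u(3) A.shift_chain_add)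
  have f2: "?t f2 \<in> F (d - i)" using shift_chain_F[OF u(1), of i ?m] by (simp add: im)
  have tu: "?t u \<in> F (Suc (d - i))" using shift_chain_split[OF u(2), of ?m] by (simp add: im)
  have "y0 - ?t f2 - ?t u \<in> F (Suc (d - i))"
    using y(2) tu F_mono[OF f2, of "Suc (d - i)"] by (auto intro: F_diff)
  moreover have "y0 - ?t f2 - ?t u = ?t g" by (simp add: sum)
  moreover have "?t g \<in> D i" using A.shift_chain_lower[of g i ?m] g(2) by (simp add: im)
  ultimately have "?t g \<in> F (Suc (d - i)) \<inter> D (Suc d - Suc (d - i))"
    using assms(1) by auto
  then have "?t g = 0" using F_D_disjoint[of "Suc (d - i)"] by auto
  then have eq: "y - (A ^^ ?m) u = (f + ?t f2) + (?t u - (A ^^ ?m) u)"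
    by (simp add: y(3) sum)
  have "?t u - (A ^^ ?m) u \<in> F (d - i)" using shift_chain_power[of u i ?m] u(2) by (simp add: im)
  then have "y - (A ^^ ?m) u \<in> F (d - i)" unfolding eq using y(1) f2 by (intro F_add)
  then show thesis using that u(2) by blast
qed

lemma power_commutes_modulo:
  assumes P: "endo P" and comm: "\<And>n v. v \<in> F n \<Longrightarrow> P (A v) - scale r (A (P v)) \<in> F (n - j)"
    and v: "v \<in> F (Suc n)"
  shows "P ((A ^^ m) v) - scale (r ^ m) ((A ^^ m) (P v)) \<in> F (n + m - j)"
proof (induction m)
  case 0
  then show ?case by (simp add: zero_in_F)
next
  case (Suc m)
  let ?w = "P ((A ^^ m) v) - scale (r ^ m) ((A ^^ m) (P v))"
  have "P (A ((A ^^ m) v)) - scale r (A (P ((A ^^ m) v))) \<in> F (n + Suc m - j)"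
    using comm[OF A_power_F[OF v, of m]] by simp
  moreover have "scale r (A ?w) \<in> F (n + Suc m - j)"
    using A_power_F_diff[OF Suc.IH, of 1] by (intro F_scale) simp
  ultimately have "(P (A ((A ^^ m) v)) - scale r (A (P ((A ^^ m) v)))) + scale r (A ?w)
      \<in> F (n + Suc m - j)"
    by (rule F_add)
  then show ?case
    by (simp add: endo_simps[OF A.endo] scale_right_diff_distrib)
qed

text \<open>One step of the vanishing argument: the part of degree \<open>-j\<close> of \<open>P\<close> is zero.  In the upper
  half \<open>d < 2 i\<close>, every \<open>v\<close> is raised from a lower piece, modulo \<open>F i\<close>.  In the lower half, modulo
  raised elements, \<open>v\<close> can be chosen primitive, that is, with \<open>A\<^sup>m v\<close> in a lower step of
  the flag than expected, where \<open>m = d - 2 i + j\<close>.  Then \<open>A\<^sup>m\<close> also sends the leading part of \<open>P v\<close> to zero.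
  But \<open>P v\<close> lives on the piece at \<open>i - j\<close>, where even the higher power \<open>A\<^sup>m\<^sup>+\<^sup>j\<close> is injective.\<close>

lemma lower_degree:
  assumes P: "endo P" and r: "r \<noteq> 0" and j: "1 \<le> j"
    and deg: "\<And>n v. v \<in> F n \<Longrightarrow> P v \<in> F (n - j)"
    and comm: "\<And>n v. v \<in> F n \<Longrightarrow> P (A v) - scale r (A (P v)) \<in> F (n - j)"
  shows "v \<in> F (Suc i) \<Longrightarrow> P v \<in> F (i - j)"
proof (induction i arbitrary: v rule: less_induct)
  case (less i)
  \<comment> \<open>Elements raised from a lower piece by a power of \<open>A\<close> are covered by induction.\<close>
  have raised: "P ((A ^^ m) w) \<in> F (k + m - j)" if "w \<in> F (Suc k)" "k < i" for w k m
  proof -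
    have "P ((A ^^ m) w) - scale (r ^ m) ((A ^^ m) (P w)) \<in> F (k + m - j)"
      by (rule power_commutes_modulo[OF P comm that(1)])
    moreover have "scale (r ^ m) ((A ^^ m) (P w)) \<in> F (k + m - j)"
      using less.IH[OF that(2,1)] by (intro F_scale A_power_F_diff)
    ultimately have "(P ((A ^^ m) w) - scale (r ^ m) ((A ^^ m) (P w)))
        + scale (r ^ m) ((A ^^ m) (P w)) \<in> F (k + m - j)" by (rule F_add)
    then show ?thesis by simp
  qed
  consider "d < i" | "i < j" | "j \<le> i" "2 * i \<le> d" | "i \<le> d" "d < 2 * i" by linarith
  then show ?case
  proof cases
    case 1
    then show ?thesis using deg[of v i] by (simp add: As.lower_top)
  next
    case 2
    then show ?thesis using deg[OF less.prems] by simp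
  next
    case 3
    define k m where "k = i - j" and "m = d - 2 * i + j"
    have km: "k < i" "k + j = i" "2 * k \<le> d" "d - 2 * k = m + j" "Suc i + m = Suc (d - k)"
      "d - k - j = d - i" "i + m - j = d - i" "d - i + j = d - k"
      using 3 j by (auto simp: k_def m_def)
    have "(A ^^ m) v \<in> F (Suc (d - k))" using A_power_F[OF less.prems, of m] by (simp only: km)
    then obtain w where w: "w \<in> F (Suc k)" "(A ^^ m) v - (A ^^ (m + j)) w \<in> F (d - k)"
      using lefschetz_surjective[OF km(3)] unfolding km(4) by blast
    define v' where "v' = v - (A ^^ j) w"
    have Aw: "(A ^^ j) w \<in> F (Suc i)" using A_power_F[OF w(1), of j] km(2) by simp
    have v': "v' \<in> F (Suc i)" unfolding v'_def using less.prems Aw by (rule F_diff)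
    have "(A ^^ m) v' \<in> F (d - k)"
      using w(2) by (simp add: v'_def endo_simps[OF endo_A_power] funpow_add)
    then have "P ((A ^^ m) v') \<in> F (d - i)" using deg km(6) by metis
    moreover have "P ((A ^^ m) v') - scale (r ^ m) ((A ^^ m) (P v')) \<in> F (d - i)"
      using power_commutes_modulo[OF P comm v', of m] by (simp only: km)
    ultimately have "P ((A ^^ m) v') - (P ((A ^^ m) v') - scale (r ^ m) ((A ^^ m) (P v')))
        \<in> F (d - i)" by (rule F_diff)
    then have "scale (r ^ m) ((A ^^ m) (P v')) \<in> F (d - i)" by simp
    from F_scale[OF this, of "inverse (r ^ m)"] have "(A ^^ m) (P v') \<in> F (d - i)"
      using r by (simp add: field_simps)
    then have "(A ^^ j) ((A ^^ m) (P v')) \<in> F (d - i + j)" by (rule A_power_F)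
    then have "(A ^^ (d - 2 * k)) (P v') \<in> F (d - k)"
      unfolding km by (simp add: funpow_add[of j m, unfolded add.commute[of j m]])
    moreover have "P v' \<in> F (Suc k)" using deg[OF v'] 3(1) by (simp add: k_def Suc_diff_le)
    ultimately have "P v' \<in> F k" by (intro lefschetz_injective[OF km(3)])
    moreover have "P ((A ^^ j) w) \<in> F k" using raised[OF w(1) km(1), of j] by simp
    ultimately have "P v' + P ((A ^^ j) w) \<in> F k" by (rule F_add)
    then show ?thesis by (simp add: v'_def endo_simps[OF P] k_def)
  next
    case 4
    define k where "k = d - i"
    have k: "2 * k \<le> d" "d - k = i" "k < i" "k + (d - 2 * k) = i" using 4 by (auto simp: k_def)
    obtain x where x: "x \<in> F (Suc k)" "v - (A ^^ (d - 2 * k)) x \<in> F i"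
      using lefschetz_surjective[OF k(1), of v] less.prems unfolding k(2) by blast
    have "P (v - (A ^^ (d - 2 * k)) x) \<in> F (i - j)" using x(2) by (rule deg)
    moreover have "P ((A ^^ (d - 2 * k)) x) \<in> F (i - j)"
      using raised[OF x(1) k(3), of "d - 2 * k"] by (simp only: k)
    ultimately have "P (v - (A ^^ (d - 2 * k)) x) + P ((A ^^ (d - 2 * k)) x) \<in> F (i - j)"
      by (rule F_add)
    then show ?thesis by (simp add: endo_simps[OF P])
  qed
qed

text \<open>The hypothesis \<open>comm\<close> says that the commutation defect is smaller by one degree than
  expected, whatever bound on the degree of \<open>P\<close> has been reached.  Each use of the preceding
  lemma improves the bound by one, until it exceeds the length of the flag.\<close>

lemma lowering_map_vanishes:
  assumes P: "endo P" and r: "r \<noteq> 0"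
    and deg: "\<And>n v. v \<in> F n \<Longrightarrow> P v \<in> F (n - 1)"
    and comm: "\<And>j n v. (\<And>n v. v \<in> F n \<Longrightarrow> P v \<in> F (n - j)) \<Longrightarrow> v \<in> F n
      \<Longrightarrow> P (A v) - scale r (A (P v)) \<in> F (n - j)"
  shows "P v = 0"
proof -
  have "\<forall>n. \<forall>v\<in>F n. P v \<in> F (n - Suc j)" for j
  proof (induction j)
    case 0
    then show ?case using deg by simp
  next
    case (Suc j)
    show ?case
    proof (intro allI ballI)
      fix n v assume v: "v \<in> F n"
      show "P v \<in> F (n - Suc (Suc j))"
      proof (cases n)
        case 0
        then show ?thesis using v by (simp add: As.lower_0 endo_simps[OF P])
      next
        case n: (Suc i)
        have "P v \<in> F (i - Suc j)"
        proof (rule lower_degree[OF P r])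
          show "P v \<in> F (n - Suc j)" if "v \<in> F n" for n v using Suc.IH that by blast
          show "P (A v) - scale r (A (P v)) \<in> F (n - Suc j)" if "v \<in> F n" for n v
            using Suc.IH that by (intro comm) blast
        qed (use v n in auto)
        then show ?thesis using n by simp
      qed
    qed
  qed
  then have "\<forall>v\<in>F (Suc d). P v \<in> F (Suc d - Suc d)" by blast
  then have "P v \<in> F (Suc d - Suc d)" by (simp add: As.lower_top)
  then show ?thesis by (simp add: As.lower_0)
qed

end

section \<open>Relations between the split maps\<close>

context linear_algebra
begin

lemmas scale_expand = scale_right_distrib scale_right_diff_distrib

lemma eq_from_scaled:
  assumes "scale c x = scale c y" "c \<noteq> 0"
  shows "x = y"
  using assms by simp

text \<open>The relations of \<open>A\<close> with \<open>K = M + b N\<close> and \<open>B = M + a N\<close>, where \<open>b = a\<^sup>-\<^sup>1\<close>, are two linear equations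
  for the brackets of \<open>A\<close> with \<open>M\<close> and \<open>N\<close>.  Solving them removes \<open>a\<close> from the bracket with \<open>N\<close> and
  leaves only the symmetric combination \<open>a + b\<close> in the one with \<open>M\<close>.\<close>

lemma lowering_diagonal_relations:
  assumes M: "endo M" and N: "endo N" and A: "endo A"
    and ab: "a * b = 1" "a \<noteq> b"
    and K: "\<And>v. K v = M v + scale b (N v)" and B: "\<And>v. B v = M v + scale a (N v)"
    and KA: "\<And>v. scale q (K (A v)) - scale p (A (K v)) = scale c (scale a (K (K v)) + scale b v)"
    and BA: "\<And>v. scale q (B (A v)) - scale p (A (B v)) = scale c (scale b (B (B v)) + scale a v)"
  shows "scale q (N (A v)) - scale p (A (N v)) = scale c (v - M (M v) + N (N v))" (is ?N)
    and "scale q (M (A v)) - scale p (A (M v))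
      = scale c (scale (a + b) (M (M v)) + M (N v) + N (M v))" (is ?M)
proof -
  define x where "x = scale q (M (A v)) - scale p (A (M v))"
  define y where "y = scale q (N (A v)) - scale p (A (N v))"
  note lin = endo_simps[OF M] endo_simps[OF N] endo_simps[OF A]
  have ab': "b * a = 1" "a * (b * b) = b" "b * (a * a) = a"
    using ab(1) by (simp_all add: mult.commute mult.left_commute)
  have "scale q (K (A v)) - scale p (A (K v)) = x + scale b y"
    by (simp add: x_def y_def K lin scale_expand algebra_simps)
  moreover have "scale a (K (K v)) = scale a (M (M v)) + M (N v) + N (M v) + scale b (N (N v))"
    by (simp add: K lin scale_expand ab ab')
  ultimately have xK: "x + scale b y
      = scale c (scale a (M (M v)) + M (N v) + N (M v) + scale b (N (N v)) + scale b v)"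
    using KA[of v] by (simp only:)
  have "scale q (B (A v)) - scale p (A (B v)) = x + scale a y"
    by (simp add: x_def y_def B lin scale_expand algebra_simps)
  moreover have "scale b (B (B v)) = scale b (M (M v)) + M (N v) + N (M v) + scale a (N (N v))"
    by (simp add: B lin scale_expand ab ab')
  ultimately have xB: "x + scale a y
      = scale c (scale b (M (M v)) + M (N v) + N (M v) + scale a (N (N v)) + scale a v)"
    using BA[of v] by (simp only:)
  have "scale (a - b) y = (x + scale a y) - (x + scale b y)"
    by (simp add: scale_left_diff_distrib)
  also have "\<dots> = scale (a - b) (scale c (v - M (M v) + N (N v)))"
    unfolding xK xB by (simp add: scale_left_diff_distrib scale_expand algebra_simps)
  finally have y: "y = scale c (v - M (M v) + N (N v))"
    by (rule eq_from_scaled) (use ab(2) in simp)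
  then show ?N by (simp add: y_def)
  have "x = (x + scale b y) - scale b y" by simp
  also have "\<dots> = scale c (scale (a + b) (M (M v)) + M (N v) + N (M v))"
    unfolding xK by (simp add: y scale_left_distrib scale_expand algebra_simps)
  finally show ?M by (simp add: x_def)
qed

text \<open>Each term on the right contains \<open>Q\<close> once, together with \<open>M\<close> or \<open>N\<close>.  If these preserve a flag that
  \<open>A\<close> raises by one step, any bound on the degree of \<open>Q\<close> also bounds the right-hand side, one degree
  below what the left-hand side suggests.\<close>

lemma commutator_defect_relation:
  assumes M: "endo M" and N: "endo N" and A: "endo A"
    and NA: "\<And>v. scale q (N (A v)) - scale p (A (N v)) = scale c (v - M (M v) + N (N v))"
    and MA: "\<And>v. scale q (M (A v)) - scale p (A (M v))
      = scale c (scale s (M (M v)) + M (N v) + N (M v))"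
    and Q: "\<And>v. Q v = scale q (N (M v)) - scale p (M (N v))"
  shows "scale (q * q) (Q (A v)) - scale (p * p) (A (Q v))
    = scale c (scale s (scale q (Q (M v)) + scale p (M (Q v))) + scale (q + p) (N (Q v) + Q (N v)))"
proof -
  note lin = endo_simps[OF M] endo_simps[OF N] endo_simps[OF A]
  have NM: "scale (q * q) (N (M (A v))) - scale (p * p) (A (N (M v)))
    = scale q (scale c (scale s (N (M (M v))) + N (M (N v)) + N (N (M v))))
      + scale p (scale c (M v - M (M (M v)) + N (N (M v))))"
    using arg_cong[OF MA[of v], of "\<lambda>x. scale q (N x)"] arg_cong[OF NA[of "M v"], of "scale p"]
    by (simp add: lin scale_expand algebra_simps)
  have MN: "scale (q * q) (M (N (A v))) - scale (p * p) (A (M (N v)))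
    = scale q (scale c (M v - M (M (M v)) + M (N (N v))))
      + scale p (scale c (scale s (M (M (N v))) + M (N (N v)) + N (M (N v))))"
    using arg_cong[OF NA[of v], of "\<lambda>x. scale q (M x)"] arg_cong[OF MA[of "N v"], of "scale p"]
    by (simp add: lin scale_expand algebra_simps)
  have "scale (q * q) (Q (A v)) - scale (p * p) (A (Q v))
    = scale q (scale (q * q) (N (M (A v))) - scale (p * p) (A (N (M v))))
      - scale p (scale (q * q) (M (N (A v))) - scale (p * p) (A (M (N v))))"
    by (simp add: Q lin scale_expand algebra_simps)
  also have "\<dots> = scale c (scale s (scale q (Q (M v)) + scale p (M (Q v)))
      + scale (q + p) (N (Q v) + Q (N v)))"
    unfolding NM MN by (simp add: Q lin scale_expand scale_left_distrib algebra_simps)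
  finally show ?thesis .
qed

lemma endo_zero_of_span:
  assumes "endo R" "\<And>u. u \<in> S \<Longrightarrow> R u = 0" "span S = UNIV"
  shows "R v = 0"
proof -
  have "subspace {v. R v = 0}"
    unfolding subspace_def by (simp add: endo_simps[OF assms(1)])
  then have "span S \<subseteq> {v. R v = 0}"
    by (rule span_minimal[rotated]) (use assms(2) in auto)
  then show ?thesis using assms(3) by auto
qed

lemma bij_of_triangular:
  assumes T: "endo T" and sub: "\<And>i. subspace (\<Phi> i)" and ends: "\<Phi> 0 = {0}" "\<Phi> n = UNIV"
    and tri: "\<And>i v. i < n \<Longrightarrow> v \<in> \<Phi> (Suc i) \<Longrightarrow> T v - scale (k i) v \<in> \<Phi> i"
    and k: "\<And>i. i < n \<Longrightarrow> k i \<noteq> 0"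
  shows "bij T"
proof -
  have inj: "v \<in> \<Phi> i \<Longrightarrow> T v = 0 \<Longrightarrow> i \<le> n \<Longrightarrow> v = 0" for i v
  proof (induction i)
    case 0
    then show ?case using ends by simp
  next
    case (Suc i)
    then have "- scale (k i) v \<in> \<Phi> i" using tri[of i v] by simp
    then have "scale (inverse (k i)) (scale (k i) v) \<in> \<Phi> i"
      using subspace_neg[OF sub] subspace_scale[OF sub] by fastforce
    then show ?case using Suc k[of i] by simp
  qed
  have surj: "v \<in> \<Phi> i \<Longrightarrow> i \<le> n \<Longrightarrow> v \<in> range T" for i v
  proof (induction i arbitrary: v)
    case 0
    then have "v = T 0" using ends by (simp add: endo_simps[OF T])
    then show ?case by blast
  next
    case (Suc i)
    let ?w = "T v - scale (k i) v"
    obtain u where "T u = ?w" using Suc tri[of i v] by (metis Suc_leD Suc_le_lessD imageE)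
    then have "T (scale (inverse (k i)) (v - u)) = v"
      using k[of i] Suc.prems(2) by (simp add: endo_simps[OF T])
    then show ?case by (metis rangeI)
  qed
  have "inj T"
    using inj[of _ n] ends by (intro injI) (metis T UNIV_I endo_simps(2) le_refl right_minus_eq)
  moreover have "surj T" using surj[of _ n] ends by auto
  ultimately show ?thesis by (rule bijI)
qed

lemma endo_inv:
  assumes T: "endo T" and "bij T"
  shows "endo (inv_into UNIV T)" "bij (inv_into UNIV T)"
proof -
  let ?S = "inv_into UNIV T"
  have TS: "T (?S v) = v" and ST: "?S (T v) = v" for v
    using \<open>bij T\<close> by (simp_all add: bij_is_surj surj_f_inv_f bij_is_inj)
  show "endo ?S"
  proof (rule endoI)
    show "?S (x + y) = ?S x + ?S y" for x y
      using ST[of "?S x + ?S y"] by (simp add: endo_simps[OF T] TS)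
    show "?S (scale c x) = scale c (?S x)" for c x
      using ST[of "scale c (?S x)"] by (simp add: endo_simps[OF T] TS)
  qed
  show "bij (inv_into UNIV T)" using \<open>bij T\<close> by (rule bij_imp_bij_inv)
qed

text \<open>A relation containing \<open>M\<^sup>-\<^sup>1\<close> is proved after multiplication by \<open>M\<close> on both sides.  It then reads
  \<open>q K M - q\<^sup>-\<^sup>1 M K = c M\<^sup>2\<close> or \<open>q M X - q\<^sup>-\<^sup>1 X M = c M\<^sup>2\<close> with \<open>c = q - q\<^sup>-\<^sup>1\<close>, and in both the terms other than
  \<open>M\<^sup>2\<close> cancel by \<open>q N M = q\<^sup>-\<^sup>1 M N\<close>.  Stated for \<open>a\<close> and \<open>b = a\<^sup>-\<^sup>1\<close> separately, the lemma serves \<open>K\<close>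
  as well as \<open>B\<close>.\<close>

lemma equitable_of_lowering_diagonal:
  assumes lin: "endo A" "endo K" "endo M" "endo N" and c: "q - inverse q \<noteq> 0" and ab: "a * b = 1"
    and K: "\<And>v. K v = M v + scale b (N v)"
    and KA: "\<And>v. scale q (K (A v)) - scale (inverse q) (A (K v))
      = scale (q - inverse q) (scale a (K (K v)) + scale b v)"
    and MA: "\<And>v. scale q (M (A v)) - scale (inverse q) (A (M v))
      = scale (q - inverse q) (scale (a + b) (M (M v)) + M (N v) + N (M v))"
    and NM: "\<And>v. scale q (N (M v)) = scale (inverse q) (M (N v))"
    and X: "X = (\<lambda>v. scale a (A v) - scale (a ^ 2) (K v))"
    and bij: "bij K" "bij M" "bij X"
  shows "equitable_triple scale q (X, inv_into UNIV M, K)"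
proof -
  let ?p = "inverse q" let ?c = "q - inverse q" let ?Y = "inv_into UNIV M"
  note ls = endo_simps[OF lin(1)] endo_simps[OF lin(2)] endo_simps[OF lin(3)] endo_simps[OF lin(4)]
  have endoX: "endo X"
    unfolding X by (rule endoI) (simp_all add: ls scale_expand mult.commute)
  note Y = endo_inv[OF lin(3) bij(2)]
  have YM: "?Y (M v) = v" and MY: "M (?Y v) = v" for v
    using bij(2) by (simp_all add: bij_is_surj surj_f_inv_f bij_is_inj)
  have ab': "a * (a * b) = a" "a\<^sup>2 * b = a" using ab by (simp_all add: power2_eq_square mult.assoc)
  have KM: "scale q (K (M v)) - scale ?p (M (K v)) = scale ?c (M (M v))" for v
  proof -
    have "scale q (K (M v)) - scale ?p (M (K v))
      = scale ?c (M (M v)) + scale b (scale q (N (M v)) - scale ?p (M (N v)))"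
      by (simp add: K ls scale_expand scale_left_diff_distrib algebra_simps)
    then show ?thesis by (simp add: NM)
  qed
  have MK: "scale q (M (K v)) - scale ?p (K (M v))
    = scale ?c (M (M v)) + scale b (scale q (M (N v)) - scale ?p (N (M v)))" for v
    by (simp add: K ls scale_expand scale_left_diff_distrib algebra_simps)
  have MX: "scale q (M (X v)) - scale ?p (X (M v)) = scale ?c (M (M v))" for v
  proof -
    have "scale q (M (X v)) - scale ?p (X (M v))
      = scale a (scale q (M (A v)) - scale ?p (A (M v)))
        - scale (a\<^sup>2) (scale q (M (K v)) - scale ?p (K (M v)))"
      by (simp add: X ls scale_expand algebra_simps)
    also have "\<dots> = scale a (scale ?c (scale (a + b) (M (M v)) + M (N v) + N (M v)))
        - (scale (a\<^sup>2) (scale ?c (M (M v))) + scale (a\<^sup>2 * b) (scale q (M (N v)) - scale ?p (N (M v))))"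
      unfolding MA MK by (simp add: scale_expand mult.assoc)
    also have "\<dots> = scale (?c * (a * b)) (M (M v))
        + scale a (scale q (N (M v)) - scale ?p (M (N v)))"
      unfolding ab'
      by (simp add: scale_expand scale_left_distrib scale_left_diff_distrib power2_eq_square algebra_simps)
    finally show ?thesis by (simp add: NM ab)
  qed
  have KX: "scale q (K (X v)) - scale ?p (X (K v)) = scale ?c v" for v
  proof -
    have "scale q (K (X v)) - scale ?p (X (K v))
      = scale a (scale q (K (A v)) - scale ?p (A (K v))) - scale (a\<^sup>2) (scale ?c (K (K v)))"
      by (simp add: X ls scale_expand scale_left_diff_distrib algebra_simps)
    also have "\<dots> = scale (?c * (a * b)) v"
      unfolding KA by (simp add: scale_expand power2_eq_square algebra_simps)
    finally show ?thesis by (simp add: ab)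
  qed
  have XY: "scale q (X (?Y v)) - scale ?p (?Y (X v)) = scale ?c v" for v
    using arg_cong[OF MX[of "?Y v"], of ?Y] by (simp add: endo_simps[OF Y(1)] YM MY)
  have YK: "scale q (?Y (K v)) - scale ?p (K (?Y v)) = scale ?c v" for v
    using arg_cong[OF KM[of "?Y v"], of ?Y] by (simp add: endo_simps[OF Y(1)] YM MY)
  show ?thesis
    unfolding equitable_triple_def using lin bij Y endoX c by (auto simp: XY YK KX)
qed

end

section \<open>The maps attached to the split decompositions\<close>

locale split_map = tridiagonal_system scale A As th ths d
  for scale :: "'f::field \<Rightarrow> 'v::ab_group_add \<Rightarrow> 'v" and A As th ths d +
  fixes q b :: 'f and K :: "'v \<Rightarrow> 'v"
  assumes q_nonzero: "q \<noteq> 0" and b_nonzero: "b \<noteq> 0"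
    and th_eq: "i \<le> d \<Longrightarrow> th i = theta q b d i"
    and K_map: "K = map_of_decomp scale q d (\<lambda>i. F (Suc i) \<inter> G i)"
begin

definition \<kappa> :: "nat \<Rightarrow> 'f" where
  "\<kappa> i = q powi (int d - 2 * int i)"

lemma endo_K: "endo K"
  by (rule split.map_of_decomp_properties(1)[OF K_map])

lemma K_split: "i \<le> d \<Longrightarrow> u \<in> F (Suc i) \<inter> G i \<Longrightarrow> K u = scale (\<kappa> i) u"
  unfolding \<kappa>_def by (rule split.map_of_decomp_properties(2)[OF K_map])

lemma \<kappa>_nonzero: "\<kappa> i \<noteq> 0"
  by (simp add: \<kappa>_def q_nonzero)

lemma \<kappa>_Suc: "q * \<kappa> (Suc i) = inverse q * \<kappa> i"
proof -
  have "q * \<kappa> (Suc i) = q powi (1 + (int d - 2 * int (Suc i)))"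
    using q_nonzero by (simp only: \<kappa>_def power_int_add power_int_1_right simp_thms)
  also have "\<dots> = q powi (- 1 + (int d - 2 * int i))" by simp
  also have "\<dots> = inverse q * \<kappa> i"
    using q_nonzero by (simp only: \<kappa>_def power_int_add power_int_minus power_int_1_right simp_thms)
  finally show ?thesis .
qed

lemma th_\<kappa>: "i \<le> d \<Longrightarrow> th i = b * \<kappa> i + inverse b * inverse (\<kappa> i)"
  using power_int_minus[of q "int d - 2 * int i"] by (simp add: th_eq theta_def \<kappa>_def)

lemma K_F: "v \<in> F n \<Longrightarrow> K v \<in> F n"
proof (induction n arbitrary: v)
  case 0
  then show ?case by (simp add: As.lower_0 endo_simps[OF endo_K])
next
  case (Suc n)
  show ?case
  proof (cases "n \<le> d")
    case True
    obtain f u where fu: "f \<in> F n" "u \<in> F (Suc n) \<inter> G n" "v = f + u"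
      by (rule split_complement[OF Suc.prems])
    then have "K v = K f + scale (\<kappa> n) u"
      using K_split[OF True fu(2)] by (simp add: endo_simps[OF endo_K])
    then show ?thesis
      using F_mono[OF Suc.IH[OF fu(1)], of "Suc n"] fu(2) by (auto intro: F_add F_scale)
  next
    case False
    then show ?thesis by (simp add: As.lower_top)
  qed
qed

lemma K_triangular_F:
  assumes "v \<in> F (Suc i)" "i \<le> d"
  shows "K v - scale (\<kappa> i) v \<in> F i"
proof -
  obtain f u where fu: "f \<in> F i" "u \<in> F (Suc i) \<inter> G i" "v = f + u"
    by (rule split_complement[OF assms(1)])
  then have "K v - scale (\<kappa> i) v = K f - scale (\<kappa> i) f"
    using K_split[OF assms(2) fu(2)] by (simp add: endo_simps[OF endo_K] scale_right_distrib)
  then show ?thesis using fu(1) by (simp add: F_diff F_scale K_F)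
qed

lemma upper_split_complement:
  assumes "v \<in> G i"
  obtains u g where "u \<in> F (Suc i) \<inter> G i" "g \<in> G (Suc i)" "v = u + g"
proof -
  obtain u g where ug: "u \<in> F (Suc i)" "g \<in> G (Suc i)" "v = u + g" by (rule F_G_sum)
  then have "u = v - g" "g \<in> G i" using A.upper_mono[of i "Suc i"] by auto
  then have "u \<in> G i" using assms by (simp add: subspace_diff A.subspace_upper)
  then show thesis using that ug by blast
qed

lemma K_G: "n \<le> Suc d \<Longrightarrow> v \<in> G n \<Longrightarrow> K v \<in> G n"
proof (induction n arbitrary: v rule: inc_induct)
  case base
  then show ?case by (simp add: A.upper_top endo_simps[OF endo_K])
next
  case (step n)
  obtain u g where ug: "u \<in> F (Suc n) \<inter> G n" "g \<in> G (Suc n)" "v = u + g"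
    by (rule upper_split_complement[OF step.prems])
  then have "K v = scale (\<kappa> n) u + K g"
    using K_split[of n u] step.hyps by (simp add: endo_simps[OF endo_K])
  moreover have "K g \<in> G n" using step.IH[OF ug(2)] A.upper_mono[of n "Suc n"] by auto
  ultimately show ?case
    using ug(1) by (simp add: subspace_add subspace_scale A.subspace_upper)
qed

lemma K_triangular_G:
  assumes "v \<in> G i" "i \<le> d"
  shows "K v - scale (\<kappa> i) v \<in> G (Suc i)"
proof -
  obtain u g where ug: "u \<in> F (Suc i) \<inter> G i" "g \<in> G (Suc i)" "v = u + g"
    by (rule upper_split_complement[OF assms(1)])
  then have "K v - scale (\<kappa> i) v = K g - scale (\<kappa> i) g"
    using K_split[OF assms(2) ug(1)] by (simp add: endo_simps[OF endo_K] scale_right_distrib)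
  then show ?thesis
    using ug(2) K_G[of "Suc i" g] assms(2) by (simp add: subspace_diff subspace_scale A.subspace_upper)
qed

lemma bij_K: "bij K"
  by (rule bij_of_triangular[where \<Phi> = F and n = "Suc d" and k = \<kappa>, OF endo_K As.subspace_lower As.lower_0])
    (simp_all add: As.lower_top K_triangular_F \<kappa>_nonzero less_Suc_eq_le)

text \<open>Since \<open>b \<theta>\<^sub>i - b\<^sup>2 \<kappa>\<^sub>i = \<kappa>\<^sub>i\<^sup>-\<^sup>1\<close>, this map is triangular on the flag \<open>G\<close> with diagonal entries \<open>\<kappa>\<^sub>i\<^sup>-\<^sup>1\<close>.\<close>

lemma bij_X: "bij (\<lambda>v. scale b (A v) - scale (b ^ 2) (K v))" (is "bij ?X")
proof (rule bij_of_triangular)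
  let ?\<Phi> = "\<lambda>i. G (Suc d - i)" and ?k = "\<lambda>i. inverse (\<kappa> (d - i))"
  show "endo ?X"
    by (rule endoI)
      (simp_all add: endo_simps[OF A.endo] endo_simps[OF endo_K] scale_expand mult.commute)
  show "subspace (?\<Phi> i)" for i by (rule A.subspace_upper)
  show "?\<Phi> 0 = {0}" "?\<Phi> (Suc d) = UNIV" by (simp_all add: A.upper_top A.upper_0)
  show "?k i \<noteq> 0" for i by (simp add: \<kappa>_nonzero)
  fix i v assume i: "i < Suc d" and v: "v \<in> ?\<Phi> (Suc i)"
  define n where "n = d - i"
  have n: "n \<le> d" "Suc d - i = Suc n" and vn: "v \<in> G n" using i v by (auto simp: n_def)
  have k: "inverse (\<kappa> n) = b * th n - b\<^sup>2 * \<kappa> n"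
    using b_nonzero by (simp add: th_\<kappa>[OF n(1)] power2_eq_square algebra_simps)
  have "?X v - scale (inverse (\<kappa> n)) v
      = scale b (A v - scale (th n) v) - scale (b\<^sup>2) (K v - scale (\<kappa> n) v)"
    unfolding k by (simp add: scale_expand scale_left_diff_distrib algebra_simps)
  also have "\<dots> \<in> G (Suc n)"
    using A.upper_shift[OF vn] K_triangular_G[OF vn n(1)]
    by (simp add: subspace_diff subspace_scale A.subspace_upper)
  finally show "?X v - scale (?k i) v \<in> ?\<Phi> i" by (simp only: n n_def[symmetric])
qed

text \<open>On the summand \<open>F (i + 1) \<inter> G i\<close> the operator \<open>A\<close> is \<open>\<theta>\<^sub>i\<close> plus a map into the next
  summand, whose \<open>K\<close>-eigenvalue is \<open>q\<^sup>-\<^sup>2\<close> times the present one.  The bracket cancels the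
  raising part.\<close>

lemma K_A_relation:
  "scale q (K (A v)) - scale (inverse q) (A (K v))
    = scale (q - inverse q) (scale b (K (K v)) + scale (inverse b) v)"
proof -
  define R where "R v = (scale q (K (A v)) - scale (inverse q) (A (K v)))
    - scale (q - inverse q) (scale b (K (K v)) + scale (inverse b) v)" for v
  note lin = endo_simps[OF A.endo] endo_simps[OF endo_K]
  have "endo R"
    by (rule endoI) (simp_all add: R_def lin scale_expand algebra_simps)
  have "R u = 0" if u: "u \<in> F (Suc i) \<inter> G i" for i u
  proof (cases "i \<le> d")
    case True
    define r where "r = A u - scale (th i) u"
    have r: "r \<in> F (Suc (Suc i)) \<inter> G (Suc i)" unfolding r_def using u by (intro shifts(1)) auto
    have Kr: "K r = scale (\<kappa> (Suc i)) r"
    proof (cases "i = d")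
      case True
      then have "r = 0" using r by (simp add: A.upper_top)
      then show ?thesis by (simp add: lin)
    next
      case False
      then show ?thesis using \<open>i \<le> d\<close> r by (intro K_split) auto
    qed
    have Ku: "K u = scale (\<kappa> i) u" by (rule K_split[OF True u])
    have Au: "A u = scale (th i) u + r" by (simp add: r_def)
    have "scale q (K (A u)) - scale (inverse q) (A (K u))
        = scale ((q - inverse q) * (th i * \<kappa> i)) u + scale (q * \<kappa> (Suc i) - inverse q * \<kappa> i) r"
      by (simp add: Ku Au Kr lin scale_expand scale_left_diff_distrib algebra_simps)
    also have "\<dots> = scale ((q - inverse q) * (b * \<kappa> i * \<kappa> i + inverse b)) u"
      using \<kappa>_nonzero[of i] by (simp add: \<kappa>_Suc th_\<kappa>[OF True] distrib_right mult.assoc)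
    also have "\<dots> = scale (q - inverse q) (scale b (K (K u)) + scale (inverse b) u)"
      by (simp add: Ku lin scale_left_distrib scale_right_distrib mult.assoc distrib_left)
    finally show ?thesis by (simp add: R_def)
  next
    case False
    then have "G i \<subseteq> {0}" using A.upper_mono[of "Suc d" i] A.upper_top by auto
    then have "u = 0" using u by auto
    then show ?thesis by (simp add: R_def lin)
  qed
  then have "R u = 0" if "u \<in> (\<Union>n. F (Suc n) \<inter> G n)" for u using that by blast
  then have "R v = 0" by (rule endo_zero_of_span[OF \<open>endo R\<close> _ span_split])
  then show ?thesis by (simp add: R_def)
qed

end

section \<open>Equitable triples from one direction of the second flag\<close>

lemma theta_reverse: "i \<le> d \<Longrightarrow> theta q a d (d - i) = theta q (inverse a) d i"
  by (simp add: theta_def of_nat_diff algebra_simps)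

lemma map_of_decomp_cong:
  "(\<And>i. i \<le> d \<Longrightarrow> W i = W' i) \<Longrightarrow> map_of_decomp scale q d W = map_of_decomp scale q d W'"
  by (simp add: map_of_decomp_def)

text \<open>Here \<open>B\<close> enters as the split map of the system with the ordering of the eigenvalues of \<open>A\<close>
  reversed, for which the parameter is \<open>a\<^sup>-\<^sup>1\<close> and the flag \<open>F\<close> is the same.\<close>

lemma (in tridiagonal_system) equitable_triples:
  assumes q: "q \<noteq> 0" "q - inverse q \<noteq> 0" and a: "a \<noteq> 0" "a - inverse a \<noteq> 0"
    and th: "\<And>i. i \<le> d \<Longrightarrow> th i = theta q a d i"
    and K: "K = map_of_decomp scale q d (\<lambda>i. F (Suc i) \<inter> G i)"
    and B: "B = map_of_decomp scale q d (\<lambda>i. F (Suc i) \<inter> D (Suc d - i))"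
    and M: "M = (\<lambda>v. scale (inverse (a - inverse a)) (scale a (K v) - scale (inverse a) (B v)))"
  shows "equitable_triple scale q
      ((\<lambda>v. scale a (A v) - scale (a ^ 2) (K v)), inv_into UNIV M, K)" (is ?K)
    and "equitable_triple scale q
      ((\<lambda>v. scale (inverse a) (A v) - scale (inverse a ^ 2) (B v)), inv_into UNIV M, B)" (is ?B)
proof -
  define p b where "p = inverse q" and "b = inverse a"
  interpret K: split_map scale A As th ths d q a K
    by unfold_locales (use q a th K in auto)
  interpret R: tridiagonal_system scale A As "\<lambda>i. th (d - i)" ths d
    by (rule reversed_A)
  have B': "B = map_of_decomp scale q d (\<lambda>i. F (Suc i) \<inter> R.G i)"
    unfolding B by (rule map_of_decomp_cong) (simp add: A.upper_reversed)
  interpret B: split_map scale A As "\<lambda>i. th (d - i)" ths d q b B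
    by unfold_locales (use q a th theta_reverse B' in \<open>auto simp: b_def\<close>)
  have bb: "inverse b = a" "a * b = 1" "b * a = 1" "a \<noteq> b"
    using a by (auto simp: b_def)
  define N where "N v = scale (inverse (b - a)) (K v - B v)" for v
  note lin = endo_simps[OF A.endo] endo_simps[OF K.endo_K] endo_simps[OF B.endo_K]
  have endo: "endo M" "endo N"
    by (rule endoI; simp add: M N_def lin scale_expand algebra_simps)+
  have inv: "inverse (b - a) = - inverse (a - b)"
    using inverse_minus_eq[of "a - b"] by simp
  have K_MN: "K v = M v + scale b (N v)" and B_MN: "B v = M v + scale a (N v)" for v
  proof -
    have MN: "scale (a - b) (M v) = scale a (K v) - scale b (B v)"
      "scale (a - b) (N v) = B v - K v"
      using bb(4) by (simp_all add: M N_def b_def[symmetric] inv)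
    have "scale (a - b) (M v + scale e (N v)) = scale (a - b) (M v) + scale e (scale (a - b) (N v))"
      for e by (simp add: scale_expand mult.commute)
    then have "scale (a - b) (M v + scale b (N v)) = scale (a - b) (K v)"
      "scale (a - b) (M v + scale a (N v)) = scale (a - b) (B v)"
      unfolding MN by (simp_all add: scale_expand scale_left_diff_distrib)
    then show "K v = M v + scale b (N v)" "B v = M v + scale a (N v)"
      using bb(4) by simp_all
  qed
  note rel = lowering_diagonal_relations[OF endo A.endo bb(2,4) K_MN B_MN
      K.K_A_relation[folded p_def b_def] B.K_A_relation[folded p_def, unfolded bb]]
  \<comment> \<open>\<open>M\<close> respects the flag \<open>F\<close>, and \<open>N\<close> lowers it since \<open>K\<close> and \<open>B\<close> agree on the quotients.\<close>
  have M_F: "M v \<in> F n" if "v \<in> F n" for v n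
    using that K.K_F B.K_F by (simp add: M F_diff F_scale)
  have N_F: "N v \<in> F (n - 1)" if v: "v \<in> F n" for v n
  proof (cases n)
    case 0
    then show ?thesis using v by (simp add: As.lower_0 endo_simps[OF endo(2)])
  next
    case (Suc i)
    show ?thesis
    proof (cases "i \<le> d")
      case True
      have "(K v - scale (K.\<kappa> i) v) - (B v - scale (B.\<kappa> i) v) \<in> F i"
        using F_diff[OF K.K_triangular_F[of v i] B.K_triangular_F[of v i]] v Suc True by simp
      then have "K v - B v \<in> F i" by simp
      then show ?thesis using Suc by (simp add: N_def F_scale)
    qed (simp add: Suc As.lower_top)
  qed
  have M_triangular: "M v - scale (K.\<kappa> i) v \<in> F i" if "v \<in> F (Suc i)" "i \<le> d" for v i
  proof -
    have "(K v - scale (K.\<kappa> i) v) - scale b (N v) \<in> F i"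
      using N_F[OF that(1)] by (intro F_diff[OF K.K_triangular_F[OF that] F_scale]) simp
    then show ?thesis by (simp add: K_MN algebra_simps)
  qed
  have bij_M: "bij M"
    by (rule bij_of_triangular[where \<Phi> = F and n = "Suc d" and k = K.\<kappa>,
          OF endo(1) As.subspace_lower As.lower_0])
      (simp_all add: As.lower_top M_triangular K.\<kappa>_nonzero less_Suc_eq_le)
  define Q where "Q v = scale q (N (M v)) - scale p (M (N v))" for v
  have endo_Q: "endo Q"
    by (rule endoI)
      (simp_all add: Q_def endo_simps[OF endo(1)] endo_simps[OF endo(2)] scale_expand algebra_simps)
  have "Q v = 0" for v
  proof (rule lowering_map_vanishes[OF endo_Q])
    \<comment> \<open>\<open>q\<^sup>2 Q A - q\<^sup>-\<^sup>2 A Q\<close> is \<open>q\<^sup>2\<close> times \<open>Q A - q\<^sup>-\<^sup>4 A Q\<close>.\<close>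
    show "p * p * (p * p) \<noteq> 0" using q(1) by (simp add: p_def)
    show "Q v \<in> F (n - 1)" if "v \<in> F n" for n v
      unfolding Q_def using that by (intro F_diff F_scale N_F M_F)
    fix j n v
    assume deg: "\<And>n v. v \<in> F n \<Longrightarrow> Q v \<in> F (n - j)" and v: "v \<in> F n"
    have N_F': "N v \<in> F n" if "v \<in> F n" for v n
      using F_mono[OF N_F[OF that], of n] by simp
    let ?r = "scale (q - p) (scale (a + b) (scale q (Q (M v)) + scale p (M (Q v)))
        + scale (q + p) (N (Q v) + Q (N v)))"
    have r: "?r \<in> F (n - j)"
      using v by (intro F_scale F_add deg M_F N_F')
    have "Q (A v) - scale (p * p * (p * p)) (A (Q v))
        = scale (p * p) (scale (q * q) (Q (A v)) - scale (p * p) (A (Q v)))"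
      using q(1) by (simp add: p_def scale_expand field_simps)
    also have "scale (q * q) (Q (A v)) - scale (p * p) (A (Q v)) = ?r"
      by (rule commutator_defect_relation[OF endo A.endo rel Q_def])
    finally show "Q (A v) - scale (p * p * (p * p)) (A (Q v)) \<in> F (n - j)"
      by (simp only: F_scale[OF r])
  qed
  then have NM: "scale q (N (M v)) = scale (inverse q) (M (N v))" for v
    by (simp add: Q_def p_def)
  have rel': "scale q (M (A v)) - scale (inverse q) (A (M v))
      = scale (q - inverse q) (scale (b + a) (M (M v)) + M (N v) + N (M v))" for v
    using rel(2)[of v] by (simp add: p_def add.commute)
  show ?K
    by (rule equitable_of_lowering_diagonal[OF A.endo K.endo_K endo q(2) bb(2) K_MN
          K.K_A_relation[folded b_def] rel(2)[unfolded p_def] NM refl K.bij_K bij_M K.bij_X])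
  show ?B
    using equitable_of_lowering_diagonal[OF A.endo B.endo_K endo q(2) bb(3) B_MN
        B.K_A_relation[unfolded bb(1)] rel' NM refl B.bij_K bij_M B.bij_X]
    by (simp only: b_def)
qed

section \<open>Modules of the q-Onsager algebra\<close>

lemma ring_free_ring: "ring (free_ring :: ('f::field) free_alg ring)"
proof (rule ringI)
  show "abelian_group (free_ring :: 'f free_alg ring)"
  proof (rule abelian_groupI)
    fix x :: "'f free_alg"
    show "\<exists>y\<in>carrier free_ring. y \<oplus>\<^bsub>free_ring\<^esub> x = \<zero>\<^bsub>free_ring\<^esub>"
      by (intro bexI[of _ "- x"]) (simp_all add: free_ring_def)
  qed (simp_all add: free_ring_def ac_simps)
  show "Group.monoid (free_ring :: 'f free_alg ring)"
    by (rule Group.monoidI) (simp_all add: free_ring_def mult.assoc)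
qed (simp_all add: free_ring_def distrib_left distrib_right)

lemma ideal_onsager: "ideal (onsager_ideal q) free_ring"
  unfolding onsager_ideal_def
  by (rule ring.genideal_ideal[OF ring_free_ring]) (simp add: free_ring_def)

lemma relator_in_onsager_ideal:
  "onsager_relator q (fgen GenA) (fgen GenAstar) \<in> onsager_ideal q"
  using ring.genideal_self[OF ring_free_ring, of
      "{onsager_relator q (fgen GenA) (fgen GenAstar), onsager_relator q (fgen GenAstar) (fgen GenA)}"]
  by (simp add: onsager_ideal_def free_ring_def)

lemma oq_class_ring_hom: "oq_class q \<in> ring_hom free_ring (q_onsager q)"
proof -
  have "oq_class q = (+>\<^bsub>free_ring\<^esub>) (onsager_ideal q)"
    by (rule ext) (simp add: oq_class_def)
  then show ?thesis
    unfolding q_onsager_def using ideal.rcos_ring_hom[OF ideal_onsager] by metis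
qed

lemma oq_class_of_ideal: "x \<in> onsager_ideal q \<Longrightarrow> oq_class q x = oq_class q 0"
proof -
  interpret ideal "onsager_ideal q" free_ring by (rule ideal_onsager)
  have "0 \<in> onsager_ideal q" 
    using additive_subgroup.zero_closed[OF ideal.axioms(1)[OF ideal_onsager]]
    by (simp add: free_ring_def)
  then show "x \<in> onsager_ideal q \<Longrightarrow> oq_class q x = oq_class q 0"
    by (simp add: oq_class_def a_rcos_const)
qed

lemma carrier_q_onsager: "x \<in> carrier (q_onsager q) \<Longrightarrow> \<exists>r. x = oq_class q r"
  unfolding q_onsager_def FactRing_def A_RCOSETS_def' oq_class_def by auto

text \<open>A module is handled through the action of the free algebra, in which elements can be
  analysed word by word.\<close>

locale onsager_rep = linear_algebra scale
  for scale :: "'f::field \<Rightarrow> 'v::ab_group_add \<Rightarrow> 'v" +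
  fixes q :: 'f and \<rho> :: "'f free_alg set \<Rightarrow> 'v \<Rightarrow> 'v"
  assumes module_\<rho>: "onsager_module scale q \<rho>"
begin

definition act :: "'f free_alg \<Rightarrow> 'v \<Rightarrow> 'v" where
  "act x = \<rho> (oq_class q x)"

lemma act_ring_hom: "act \<in> ring_hom free_ring (endo_ring scale)"
  using ring_hom_trans[OF oq_class_ring_hom] module_\<rho>
  unfolding onsager_module_def act_def comp_def by blast

lemma endo_act: "endo (act x)"
  using ring_hom_closed[OF act_ring_hom, of x] by (simp add: free_ring_def endo_ring_def)

lemma act_add: "act (x + y) v = act x v + act y v"
  using ring_hom_add[OF act_ring_hom, of x y] by (simp add: free_ring_def endo_ring_def)

lemma act_mult: "act (x * y) v = act x (act y v)"
  using ring_hom_mult[OF act_ring_hom, of x y] by (simp add: free_ring_def endo_ring_def)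

lemma act_one: "act 1 v = v"
  using ring_hom_one[OF act_ring_hom] by (simp add: free_ring_def endo_ring_def)

lemma act_fscalar: "act (fscalar c) v = scale c v"
  using module_\<rho> by (simp add: onsager_module_def act_def)

lemma act_zero: "act 0 v = 0"
  using act_add[of 0 0 v] by simp

lemma act_diff: "act (x - y) v = act x v - act y v"
  using act_add[of "x - y" y v] by simp

lemma act_relator: "act (onsager_relator q (fgen GenA) (fgen GenAstar)) v = 0"
  using oq_class_of_ideal[OF relator_in_onsager_ideal, of q] act_zero[of v] by (simp add: act_def)

lemma generators_invariant_imp_invariant:
  assumes W: "subspace W" and inv: "\<And>g w. w \<in> W \<Longrightarrow> act (fgen g) w \<in> W" and w: "w \<in> W"
  shows "act x w \<in> W"
proof -
  have word: "w \<in> W \<Longrightarrow> act (Poly_Mapping.single (Word gs) 1) w \<in> W" for gs w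
  proof (induction gs)
    case Nil
    have "Poly_Mapping.single (Word []) 1 = (1 :: 'f free_alg)"
      by (metis single_one zero_word_def)
    then show ?case using Nil by (simp add: act_one)
  next
    case (Cons g gs)
    have "Poly_Mapping.single (Word (g # gs)) 1
        = fgen g * (Poly_Mapping.single (Word gs) 1 :: 'f free_alg)"
      by (simp add: fgen_def mult_single plus_word_def)
    then show ?case using inv[OF Cons.IH[OF Cons.prems]] by (simp add: act_mult)
  qed
  have single: "act (Poly_Mapping.single u c) w \<in> W" for u c
  proof -
    have "Poly_Mapping.single u c = fscalar c * Poly_Mapping.single (Word (letters u)) 1"
      by (simp add: fscalar_def mult_single)
    then show ?thesis
      using word[OF w, of "letters u"] W by (simp add: act_mult act_fscalar subspace_scale)
  qed
  show ?thesis
  proof (induction x rule: update_induct)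
    case const
    then show ?case using W by (simp add: act_zero subspace_0)
  next
    case (update f a b)
    have "Poly_Mapping.update a b f = f + Poly_Mapping.single a b"
      using update.hyps
      by (intro poly_mapping_eqI) (auto simp: lookup_update lookup_add lookup_single in_keys_iff when_def)
    then show ?case using update.IH single[of a b] W by (simp add: act_add subspace_add)
  qed
qed

end

text \<open>Up to the factor \<open>\<theta>\<^sub>j - \<theta>\<^sub>i\<close>, this is the scalar by which the first defining relation acts
  from the eigenspace of \<open>A\<close> for \<open>\<theta>\<^sub>i\<close> to the one for \<open>\<theta>\<^sub>j\<close>.  With \<open>\<theta>\<^sub>i = x + x\<^sup>-\<^sup>1\<close> it factors as
  \<open>(\<theta>\<^sub>j - (q\<^sup>2 x + q\<^sup>-\<^sup>2 x\<^sup>-\<^sup>1)) (\<theta>\<^sub>j - (q\<^sup>-\<^sup>2 x + q\<^sup>2 x\<^sup>-\<^sup>1))\<close>, and each factor splits further because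
  \<open>y + y\<^sup>-\<^sup>1 = z + z\<^sup>-\<^sup>1\<close> only for \<open>y = z\<close> and \<open>y z = 1\<close>.  Of the four resulting coincidences, two make \<open>q\<close> a
  root of unity and two make \<open>\<theta>\<^sub>i = \<theta>\<^sub>j\<^sub>-\<^sub>1\<close> or \<open>\<theta>\<^sub>i\<^sub>+\<^sub>1 = \<theta>\<^sub>j\<close>.\<close>

lemma relation_factor_nonzero:
  fixes q a :: "'f::field"
  assumes q: "q \<noteq> 0" "\<forall>n::nat. n > 0 \<longrightarrow> q ^ n \<noteq> 1" and a: "a \<noteq> 0"
    and inj: "inj_on (theta q a d) {0..d}" and ij: "i + 2 \<le> j" "j \<le> d"
  shows "(theta q a d i)\<^sup>2 + (theta q a d j)\<^sup>2 - (q\<^sup>2 + (inverse q)\<^sup>2) * theta q a d i * theta q a d j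
    + (q\<^sup>2 - (inverse q)\<^sup>2)\<^sup>2 \<noteq> 0"
proof -
  define x where "x k = a * q powi (int d - 2 * int k)" for k
  have x0: "x k \<noteq> 0" for k using q a by (simp add: x_def)
  have th: "theta q a d k = x k + inverse (x k)" for k
    using power_int_minus[of q "int d - 2 * int k"] by (simp add: theta_def x_def)
  have x_add: "x k = x (k + m) * q ^ (2 * m)" for k m
  proof -
    have "q powi (int d - 2 * int k) = q powi ((int d - 2 * int (k + m)) + int (2 * m))"
      by (rule arg_cong[of _ _ "\<lambda>e. q powi e"]) simp
    also have "\<dots> = q powi (int d - 2 * int (k + m)) * q ^ (2 * m)"
      using q(1) by (subst power_int_add) (simp_all del: of_nat_mult)
    finally show ?thesis by (simp add: x_def)
  qed
  have inv: "x k * x l \<noteq> 1" if "k < l" "l \<le> d" for k l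
  proof
    assume "x k * x l = 1"
    then have "inverse (x k) = x l" "inverse (x l) = x k"
      using inverse_unique[of "x k" "x l"] inverse_unique[of "x l" "x k"] by (simp_all add: mult.commute)
    then have "theta q a d k = theta q a d l" by (simp add: th)
    then show False using inj_onD[OF inj, of k l] that by auto
  qed
  let ?X = "x i" and ?Y = "x j"
  have i1: "x i = x (i + 1) * q\<^sup>2" using x_add[of i 1] by simp
  have j1: "x (j - 1) = x j * q\<^sup>2" using x_add[of "j - 1" 1] ij by simp
  have xij: "x i = x j * q ^ (2 * (j - i))" using x_add[of i "j - i"] ij by simp
  have f1: "?Y \<noteq> q\<^sup>2 * ?X"
  proof
    assume "?Y = q\<^sup>2 * ?X"
    then have "x j * 1 = x j * q ^ (2 * (j - i) + 2)" by (simp add: xij power_add power2_eq_square ac_simps)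
    then have "q ^ (2 * (j - i) + 2) = 1" using x0[of j] by (metis mult_left_cancel)
    moreover have "q ^ (2 * (j - i) + 2) \<noteq> 1" by (rule q(2)[rule_format]) simp
    ultimately show False by blast
  qed
  have f2: "?Y * q\<^sup>2 \<noteq> ?X"
  proof
    assume "?Y * q\<^sup>2 = ?X"
    moreover have "2 * (j - i) = 2 + 2 * (j - i - 1)" using ij by simp
    ultimately have "x j * q\<^sup>2 * 1 = x j * q\<^sup>2 * q ^ (2 * (j - i - 1))"
      using xij by (simp add: power_add mult.assoc power2_eq_square)
    then have "q ^ (2 * (j - i - 1)) = 1" using q(1) x0[of j] by simp
    moreover have "q ^ (2 * (j - i - 1)) \<noteq> 1" by (rule q(2)[rule_format]) (use ij in simp)
    ultimately show False by blast
  qed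
  have f3: "?Y * ?X * q\<^sup>2 \<noteq> 1"
    using inv[of i "j - 1", unfolded j1] ij by (simp add: ac_simps)
  have f4: "?Y * ?X \<noteq> q\<^sup>2"
  proof
    assume "?Y * ?X = q\<^sup>2"
    then have "q\<^sup>2 * (x (i + 1) * x j) = q\<^sup>2 * 1" by (simp add: i1 ac_simps)
    then show False using inv[of "i + 1" j] ij q(1) by simp
  qed
  have "((?X + inverse ?X)\<^sup>2 + (?Y + inverse ?Y)\<^sup>2
      - (q\<^sup>2 + (inverse q)\<^sup>2) * (?X + inverse ?X) * (?Y + inverse ?Y) + (q\<^sup>2 - (inverse q)\<^sup>2)\<^sup>2) * (?X\<^sup>2 * ?Y\<^sup>2 * q ^ 4)
    = (?Y - q\<^sup>2 * ?X) * (?Y * ?X * q\<^sup>2 - 1) * (?Y * q\<^sup>2 - ?X) * (?Y * ?X - q\<^sup>2)"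
    using x0[of i] x0[of j] q(1) by (simp add: field_simps power2_eq_square power4_eq_xxxx)
  moreover have "\<dots> \<noteq> 0" using f1 f2 f3 f4 by simp
  ultimately show ?thesis unfolding th by (metis mult_zero_left)
qed

text \<open>Applied to an eigenvector \<open>v\<close> of \<open>A\<close>, the first defining relation becomes a cubic polynomial in
  \<open>A\<close> annihilating \<open>A\<^sup>* v\<close>.  So \<open>A\<^sup>* v\<close> has no component in the
  eigenspaces whose eigenvalues are not roots of this cubic.\<close>

lemma (in onsager_rep) tridiagonal_on_eigspaces:
  assumes q: "q \<noteq> 0" "\<forall>n::nat. n > 0 \<longrightarrow> q ^ n \<noteq> 1" and a: "a \<noteq> 0"
    and ed: "eigen_decomposition scale (act (fgen GenA)) (theta q a d) d" and i: "i \<le> d"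
  shows "act (fgen GenAstar) ` eigspace scale (act (fgen GenA)) (theta q a d i)
    \<subseteq> subspace_sum (\<lambda>i. eigspace scale (act (fgen GenA)) (theta q a d i))
        {j. j \<le> d \<and> i \<le> j + 1 \<and> j \<le> i + 1}"
proof (rule image_subsetI)
  let ?A = "act (fgen GenA)" and ?As = "act (fgen GenAstar)" and ?th = "theta q a d"
  interpret eigen_decomposition scale ?A ?th d by (rule ed)
  fix v assume "v \<in> E i"
  then have Av: "?A v = scale (?th i) v" by (simp add: eigspace_def)
  define p e where "p = inverse q" and "e = (q ^ 2 - inverse q ^ 2) ^ 2"
  define w y z where "w = ?As v" and "y = scale q (?A w) - scale (p * ?th i) w"
    and "z = scale p (?A y) - scale (q * ?th i) y"
  note lin = endo_simps[OF endo_act]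
  have y: "act (qcomm q (fgen GenA) (fgen GenAstar)) v = y"
    by (simp add: qcomm_def act_diff act_mult act_fscalar Av lin y_def w_def p_def)
  have z: "act (qcomm (inverse q) (fgen GenA) (qcomm q (fgen GenA) (fgen GenAstar))) v = z"
    by (simp add: qcomm_def[of "inverse q"] act_diff act_mult act_fscalar Av lin y z_def p_def)
  have "act (comm (fgen GenA) (qcomm (inverse q) (fgen GenA) (qcomm q (fgen GenA) (fgen GenAstar)))) v
      = ?A z - scale (?th i) z"
    by (simp add: comm_def act_diff act_mult Av lin z)
  moreover have "act (fscalar e * comm (fgen GenAstar) (fgen GenA)) v
      = - scale e (?A w - scale (?th i) w)"
    by (simp add: comm_def act_diff act_mult act_fscalar Av lin w_def scale_right_diff_distrib)
  ultimately have rel: "?A z - scale (?th i) z + scale e (?A w - scale (?th i) w) = 0"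
    using act_relator[of v] by (simp add: onsager_relator_def act_diff e_def)
  have compA: "component (?A u) j = scale (?th j) (component u j)" if "j \<le> d" for u j
    using component_shift[OF that, of u 0] by simp
  have "component w j = 0" if j: "j \<le> d" "\<not> (i \<le> j + 1 \<and> j \<le> i + 1)" for j
  proof -
    let ?W = "component w j" and ?f = "(?th i)\<^sup>2 + (?th j)\<^sup>2
      - (q\<^sup>2 + (inverse q)\<^sup>2) * ?th i * ?th j + (q\<^sup>2 - (inverse q)\<^sup>2)\<^sup>2"
    have yj: "component y j = scale (q * ?th j - p * ?th i) ?W"
      using j by (simp add: y_def component_diff component_scale compA scale_left_diff_distrib)
    have "component z j = scale (p * ?th j - q * ?th i) (component y j)"
      using j by (simp add: z_def component_diff component_scale compA scale_left_diff_distrib)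
    then have zj: "component z j = scale ((p * ?th j - q * ?th i) * (q * ?th j - p * ?th i)) ?W"
      by (simp add: yj)
    have "0 = component (?A z - scale (?th i) z + scale e (?A w - scale (?th i) w)) j"
      using j by (simp add: rel component_0)
    also have "\<dots> = scale (?th j - ?th i) (component z j) + scale e (scale (?th j - ?th i) ?W)"
      using j by (simp add: component_add component_diff component_scale compA scale_left_diff_distrib)
    also have "\<dots> = scale ((?th j - ?th i) * ((p * ?th j - q * ?th i) * (q * ?th j - p * ?th i) + e)) ?W"
      by (simp add: zj distrib_left scale_left_distrib mult.commute)
    also have "(p * ?th j - q * ?th i) * (q * ?th j - p * ?th i) + e = ?f"
      using q(1) by (simp add: p_def e_def field_simps power2_eq_square)
    finally have "scale ((?th j - ?th i) * ?f) ?W = 0" by simp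
    moreover have "?th j \<noteq> ?th i"
      using inj_onD[OF eigenvalues_distinct, of j i] i j by auto
    moreover have "?f \<noteq> 0"
    proof (cases "i + 2 \<le> j")
      case True
      then show ?thesis
        using relation_factor_nonzero[OF q a, of d i j] eigenvalues_distinct j by (simp add: atMost_atLeast0)
    next
      case False
      then have "j + 2 \<le> i" using j by simp
      then have "(?th j)\<^sup>2 + (?th i)\<^sup>2 - (q\<^sup>2 + (inverse q)\<^sup>2) * ?th j * ?th i
          + (q\<^sup>2 - (inverse q)\<^sup>2)\<^sup>2 \<noteq> 0"
        using relation_factor_nonzero[OF q a, of d j i] eigenvalues_distinct i by (simp add: atMost_atLeast0)
      then show ?thesis by (simp add: ac_simps)
    qed
    ultimately show ?thesis by simp
  qed
  then show "?As v \<in> subspace_sum E {j. j \<le> d \<and> i \<le> j + 1 \<and> j \<le> i + 1}"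
    by (subst mem_subspace_sum_iff) (auto simp: w_def)
qed

section \<open>The oriented triangles of the graph\<close>

text \<open>Tagging the names with flags is injective, so the labels can be computed on the names alone.\<close>

lemma three_cycle_labels_tagged:
  "three_cycle_labels ((\<lambda>(m, T, n). ((m, f m), T, (n, f n))) ` H) = three_cycle_labels H"
proof (intro Set.set_eqI iffI)
  fix t assume "t \<in> three_cycle_labels ((\<lambda>(m, T, n). ((m, f m), T, (n, f n))) ` H)"
  then show "t \<in> three_cycle_labels H"
    unfolding three_cycle_labels_def by fastforce
next
  fix t assume "t \<in> three_cycle_labels H"
  then obtain X Y Z u v w where t: "t = (X, Y, Z)" "distinct [u, v, w]"
      "(u, X, v) \<in> H" "(v, Y, w) \<in> H" "(w, Z, u) \<in> H"
    unfolding three_cycle_labels_def by blast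
  let ?G = "(\<lambda>(m, T, n). ((m, f m), T, (n, f n))) ` H"
  have "((u, f u), X, (v, f v)) \<in> ?G" "((v, f v), Y, (w, f w)) \<in> ?G" "((w, f w), Z, (u, f u)) \<in> ?G"
    using t by (auto intro: image_eqI[rotated])
  moreover have "distinct [(u, f u), (v, f v), (w, f w)]" using t(2) by simp
  ultimately show "t \<in> three_cycle_labels ?G"
    unfolding three_cycle_labels_def t(1) by blast
qed

lemma three_cycle_labelsI:
  assumes "distinct [u, v, w]" "(u, X, v) \<in> G" "(v, Y, w) \<in> G" "(w, Z, u) \<in> G"
  shows "(X, Y, Z) \<in> three_cycle_labels G"
  unfolding three_cycle_labels_def mem_Collect_eq prod.case
  by (intro exI conjI) (rule assms)+

lemma rotations_subset_three_cycle_labels: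
  assumes "distinct [u, v, w]" "(u, X, v) \<in> G" "(v, Y, w) \<in> G" "(w, Z, u) \<in> G"
  shows "rotations (X, Y, Z) \<subseteq> three_cycle_labels G"
proof -
  have "(Y, Z, X) \<in> three_cycle_labels G"
    by (rule three_cycle_labelsI[OF _ assms(3,4,2)]) (use assms(1) in auto)
  moreover have "(Z, X, Y) \<in> three_cycle_labels G"
    by (rule three_cycle_labelsI[OF _ assms(4,2,3)]) (use assms(1) in auto)
  ultimately show ?thesis
    using three_cycle_labelsI[OF assms] by (simp add: rotations_def)
qed

lemma three_cycle_labels_arcs:
  fixes B K Bd Kd XB XK XBd XKd Y Yd :: 'l
  shows "three_cycle_labels {(V0star, B, V0), (V0star, K, Vd), (Vdstar, Bd, V0), (Vdstar, Kd, Vd),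
      (V0, XB, V0minus), (Vd, XK, V0minus), (V0, XBd, Vdminus), (Vd, XKd, Vdminus),
      (V0minus, Y, V0star), (Vdminus, Yd, Vdstar)}
    = rotations (XK, Y, K) \<union> rotations (XB, Y, B) \<union> rotations (XKd, Yd, Kd) \<union> rotations (XBd, Yd, Bd)"
    (is "three_cycle_labels ?H = ?R")
proof
  have "(T1, T2, T3) \<in> ?R"
    if H: "(u, T1, v) \<in> ?H" "(v, T2, w) \<in> ?H" "(w, T3, u) \<in> ?H" for u v w T1 T2 T3
    \<comment> \<open>The first arc fixes two vertices, after which few choices are left for the other two arcs.\<close>
    using H(1) by (elim insertE emptyE; use H(2,3) in \<open>auto simp: rotations_def\<close>)
  then show "three_cycle_labels ?H \<subseteq> ?R"
    unfolding three_cycle_labels_def by (intro subsetI) (elim CollectE case_prodE exE conjE, simp only:)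
  show "?R \<subseteq> three_cycle_labels ?H"
  proof (intro Un_least)
    show "rotations (XK, Y, K) \<subseteq> three_cycle_labels ?H"
      by (rule rotations_subset_three_cycle_labels[of Vd V0minus V0star]) simp_all
    show "rotations (XB, Y, B) \<subseteq> three_cycle_labels ?H"
      by (rule rotations_subset_three_cycle_labels[of V0 V0minus V0star]) simp_all
    show "rotations (XKd, Yd, Kd) \<subseteq> three_cycle_labels ?H"
      by (rule rotations_subset_three_cycle_labels[of Vd Vdminus Vdstar]) simp_all
    show "rotations (XBd, Yd, Bd) \<subseteq> three_cycle_labels ?H"
      by (rule rotations_subset_three_cycle_labels[of V0 Vdminus Vdstar]) simp_all
  qed
qed

lemma equitable_triple_rotate:
  "equitable_triple scale q (X, Y, Z) \<Longrightarrow> equitable_triple scale q (Y, Z, X)"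
  unfolding equitable_triple_def prod.case by blast

lemma equitable_triple_rotations:
  assumes "equitable_triple scale q (X, Y, Z)" "u \<in> rotations (X, Y, Z)"
  shows "equitable_triple scale q u"
proof -
  have "u = (X, Y, Z) \<or> u = (Y, Z, X) \<or> u = (Z, X, Y)"
    using assms(2) by (simp add: rotations_def)
  then show ?thesis
    using assms(1) equitable_triple_rotate[OF assms(1)]
      equitable_triple_rotate[OF equitable_triple_rotate[OF assms(1)]] by metis
qed

section \<open>The equitable triples\<close>

lemma (in eigen_decomposition) lower_reversed:
  assumes "i \<le> d"
  shows "eigen_decomposition.lower scale T (\<lambda>j. th (d - j)) d (Suc i) = subspace_sum E {d - i..d}"
proof -
  interpret R: eigen_decomposition scale T "\<lambda>j. th (d - j)" d by (rule reversed)
  have "(\<lambda>j. d - j) ` {j. j < Suc i \<and> j \<le> d} = {d - i..d}"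
  proof (intro Set.set_eqI iffI)
    fix j assume "j \<in> {d - i..d}"
    then have "j = d - (d - j)" "d - j \<in> {j. j < Suc i \<and> j \<le> d}" using assms by auto
    then show "j \<in> (\<lambda>j. d - j) ` {j. j < Suc i \<and> j \<le> d}" by blast
  qed (use assms in auto)
  moreover have "{j. j < Suc i \<and> j \<le> d} \<subseteq> {..d}" by auto
  ultimately show ?thesis
    using subspace_sum_rev[of "{j. j < Suc i \<and> j \<le> d}" d E] by (simp add: R.lower_def)
qed

lemma (in eigen_decomposition) lower_Suc: "i \<le> d \<Longrightarrow> lower (Suc i) = subspace_sum E {0..i}"
  unfolding lower_def by (rule arg_cong[of _ _ "subspace_sum E"]) auto

theorem theorem8p4:
  fixes q a :: "'f::field"
    and scale :: "'f \<Rightarrow> 'v::ab_group_add \<Rightarrow> 'v"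
    and \<rho> :: "'f free_alg set \<Rightarrow> 'v \<Rightarrow> 'v"
    and d :: nat
    and ths :: "nat \<Rightarrow> 'f"
    and A As K B Kd Bd M Md :: "'v \<Rightarrow> 'v"
    and V Vs :: "nat \<Rightarrow> 'v set"
    and G :: "('v vertex \<times> ('v \<Rightarrow> 'v) \<times> 'v vertex) set"
  assumes q_nonzero: "q \<noteq> 0"
    and q_not_root_of_unity: "\<forall>n::nat. n > 0 \<longrightarrow> q ^ n \<noteq> 1"
    and irreducible: "irreducible_onsager_module scale q \<rho>"
    and finite_dim: "\<exists>S::'v set. finite S \<and> module.span scale S = UNIV"
    and dim_ge_2: "vector_space.dim scale (UNIV :: 'v set) \<ge> 2"
    and A_def: "A = \<rho> (oq_class q (fgen GenA))"
    and As_def: "As = \<rho> (oq_class q (fgen GenAstar))"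
    and A_diag: "diagonalizable scale A"
    and As_diag: "diagonalizable scale As"
    and d_pos: "d \<ge> 1"
    and a_nonzero: "a \<noteq> 0"
    and theta_distinct: "inj_on (theta q a d) {0..d}"
    and A_eigvals: "eigvals scale A = theta q a d ` {0..d}"
    and V_def: "V = (\<lambda>i. eigspace scale A (theta q a d i))"
    and ths_distinct: "inj_on ths {0..d}"
    and As_eigvals: "eigvals scale As = ths ` {0..d}"
    and Vs_def: "Vs = (\<lambda>i. eigspace scale As (ths i))"
    and Vs_order: "\<forall>i\<le>d. A ` Vs i \<subseteq> subspace_sum Vs {j. j \<le> d \<and> i \<le> j + 1 \<and> j \<le> i + 1}"
    and K_def: "K = map_of_decomp scale q d
                      (\<lambda>i. subspace_sum Vs {0..i} \<inter> subspace_sum V {i..d})"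
    and B_def: "B = map_of_decomp scale q d
                      (\<lambda>i. subspace_sum Vs {0..i} \<inter> subspace_sum V {0..d - i})"
    and Kd_def: "Kd = map_of_decomp scale q d
                      (\<lambda>i. subspace_sum Vs {d - i..d} \<inter> subspace_sum V {i..d})"
    and Bd_def: "Bd = map_of_decomp scale q d
                      (\<lambda>i. subspace_sum Vs {d - i..d} \<inter> subspace_sum V {0..d - i})"
    and M_def: "M = (\<lambda>v. scale (inverse (a - inverse a)) (scale a (K v) - scale (inverse a) (B v)))"
    and Md_def: "Md = (\<lambda>v. scale (inverse (a - inverse a)) (scale a (Kd v) - scale (inverse a) (Bd v)))"
    and G_def: "G = flag_graph scale a (flag scale q a d V Vs) A K B Kd Bd M Md"
  shows "(\<forall>t \<in> three_cycle_labels G. equitable_triple scale q t) \<and>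
    three_cycle_labels G =
      rotations ((\<lambda>v. scale a (A v) - scale (a ^ 2) (K v)), inv_into UNIV M, K) \<union>
      rotations ((\<lambda>v. scale (inverse a) (A v) - scale (inverse a ^ 2) (B v)), inv_into UNIV M, B) \<union>
      rotations ((\<lambda>v. scale a (A v) - scale (a ^ 2) (Kd v)), inv_into UNIV Md, Kd) \<union>
      rotations ((\<lambda>v. scale (inverse a) (A v) - scale (inverse a ^ 2) (Bd v)), inv_into UNIV Md, Bd) \<and>
    equitable_triple scale q
      ((\<lambda>v. scale a (A v) - scale (a ^ 2) (K v)), inv_into UNIV M, K) \<and>
    equitable_triple scale q
      ((\<lambda>v. scale (inverse a) (A v) - scale (inverse a ^ 2) (B v)), inv_into UNIV M, B) \<and>
    equitable_triple scale q
      ((\<lambda>v. scale a (A v) - scale (a ^ 2) (Kd v)), inv_into UNIV Md, Kd) \<and>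
    equitable_triple scale q
      ((\<lambda>v. scale (inverse a) (A v) - scale (inverse a ^ 2) (Bd v)), inv_into UNIV Md, Bd)"
proof -
  have oq: "onsager_module scale q \<rho>"
    using irreducible by (simp add: irreducible_onsager_module_def)
  interpret onsager_rep scale q \<rho>
    by (intro onsager_rep.intro linear_algebra.intro onsager_rep_axioms.intro)
      (use oq in \<open>simp_all add: onsager_module_def\<close>)
  have act: "A = act (fgen GenA)" "As = act (fgen GenAstar)"
    by (simp_all add: A_def As_def act_def)
  have endo: "endo A" "endo As" by (simp_all add: act endo_act)
  interpret A: eigen_decomposition scale A "theta q a d" d
    by (intro eigen_decomposition.intro eigen_decomposition_axioms.intro linear_algebra_axioms endo
        diagonalizable_sum_eigspaces A_diag A_eigvals)
      (use theta_distinct in \<open>simp add: atMost_atLeast0\<close>)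
  interpret As: eigen_decomposition scale As ths d
    by (intro eigen_decomposition.intro eigen_decomposition_axioms.intro linear_algebra_axioms endo
        diagonalizable_sum_eigspaces As_diag As_eigvals)
      (use ths_distinct in \<open>simp add: atMost_atLeast0\<close>)
  interpret T: tridiagonal_system scale A As "theta q a d" ths d
  proof (intro tridiagonal_system.intro tridiagonal_system_axioms.intro linear_algebra_axioms
      A.eigen_decomposition_axioms As.eigen_decomposition_axioms)
    fix i assume i: "i \<le> d"
    show "A ` As.E i \<subseteq> subspace_sum As.E {j. j \<le> d \<and> i \<le> j + 1 \<and> j \<le> i + 1}"
      using Vs_order i by (simp add: Vs_def)
    show "As ` A.E i \<subseteq> subspace_sum A.E {j. j \<le> d \<and> i \<le> j + 1 \<and> j \<le> i + 1}"
      unfolding act using A.eigen_decomposition_axioms i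
      by (intro tridiagonal_on_eigspaces q_nonzero q_not_root_of_unity a_nonzero) (simp_all add: act)
    have "theta q a d i \<in> eigvals scale A" "ths i \<in> eigvals scale As"
      using i by (auto simp: A_eigvals As_eigvals)
    then show "A.E i \<noteq> {0}" "As.E i \<noteq> {0}"
      unfolding eigvals_def eigspace_def by blast+
  next
    fix W
    assume W: "subspace W" "\<And>w. w \<in> W \<Longrightarrow> A w \<in> W" "\<And>w. w \<in> W \<Longrightarrow> As w \<in> W"
    have gen: "act (fgen g) w \<in> W" if "w \<in> W" for g w
      using W(2,3) that by (cases g) (simp_all add: act)
    have "\<rho> x w \<in> W" if x: "x \<in> carrier (q_onsager q)" and w: "w \<in> W" for x w
    proof -
      obtain r where "x = oq_class q r" using carrier_q_onsager[OF x] by blast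
      then show ?thesis
        using generators_invariant_imp_invariant[OF W(1) gen w, of r] by (simp add: act_def)
    qed
    then show "W = {0} \<or> W = UNIV"
      using irreducible W(1) unfolding irreducible_onsager_module_def by blast
  qed
  interpret R: tridiagonal_system scale A As "theta q a d" "\<lambda>i. ths (d - i)" d
    by (rule T.reversed_As)
  have c: "q - inverse q \<noteq> 0"
  proof
    assume "q - inverse q = 0"
    then have "q ^ 2 = 1" using q_nonzero by (simp add: power2_eq_square field_simps)
    then show False using q_not_root_of_unity by (metis zero_less_numeral)
  qed
  \<comment> \<open>If \<open>a\<^sup>2 = 1\<close>, the sequence of eigenvalues is a palindrome.\<close>
  have a': "a - inverse a \<noteq> 0"
  proof
    assume "a - inverse a = 0"
    then have "theta q a d d = theta q a d 0" using theta_reverse[of 0 d q a] by simp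
    then show False using inj_onD[OF theta_distinct, of d 0] d_pos by simp
  qed
  have V: "V = A.E" and Vs: "Vs = As.E" by (simp_all add: V_def Vs_def)
  have D: "A.lower (Suc d - i) = subspace_sum V {0..d - i}" if "i \<le> d" for i
    using that A.lower_Suc[of "d - i"] by (simp add: V Suc_diff_le)
  have K: "K = map_of_decomp scale q d (\<lambda>i. T.F (Suc i) \<inter> T.G i)"
    and B: "B = map_of_decomp scale q d (\<lambda>i. T.F (Suc i) \<inter> T.D (Suc d - i))"
    unfolding K_def B_def
    by (rule map_of_decomp_cong; simp add: As.lower_Suc D Vs V A.upper_def)+
  have Kd: "Kd = map_of_decomp scale q d (\<lambda>i. R.F (Suc i) \<inter> R.G i)"
    and Bd: "Bd = map_of_decomp scale q d (\<lambda>i. R.F (Suc i) \<inter> R.D (Suc d - i))"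
    unfolding Kd_def Bd_def
    by (rule map_of_decomp_cong; simp add: As.lower_reversed D Vs V A.upper_def)+
  note up = T.equitable_triples[OF q_nonzero c a_nonzero a' refl K B M_def]
  note down = R.equitable_triples[OF q_nonzero c a_nonzero a' refl Kd Bd Md_def]
  have labels: "three_cycle_labels G =
      rotations ((\<lambda>v. scale a (A v) - scale (a ^ 2) (K v)), inv_into UNIV M, K) \<union>
      rotations ((\<lambda>v. scale (inverse a) (A v) - scale (inverse a ^ 2) (B v)), inv_into UNIV M, B) \<union>
      rotations ((\<lambda>v. scale a (A v) - scale (a ^ 2) (Kd v)), inv_into UNIV Md, Kd) \<union>
      rotations ((\<lambda>v. scale (inverse a) (A v) - scale (inverse a ^ 2) (Bd v)), inv_into UNIV Md, Bd)"
    unfolding G_def flag_graph_def three_cycle_labels_tagged by (rule three_cycle_labels_arcs)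
  have "equitable_triple scale q t" if "t \<in> three_cycle_labels G" for t
    using that up down unfolding labels by (auto intro: equitable_triple_rotations)
  then show ?thesis using labels up down by blast
qed

end
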